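(* An input sequence $\bar{\mathbf{u}} = (\mathbf{u}_0,\ldots,\mathbf{u}_N) \in \bar{U}$ is a separating input (i.e. $Y_N^{[i]}(\bar{\mathbf{u}}) \cap Y_N^{[j]}(\bar{\mathbf{u}}) = \emptyset$ for every $i,j \in \mathbb{I}$, $i\neq j$) if and only if \[ \begin{bmatrix} \mathbf{N}(i,j) \\ \boldsymbol{\Omega}(i,j) \end{bmatrix} \bar{\mathbf{u}} \notin \mathcal{Y}(i,j) = \left\{ \begin{bmatrix} \mathbf{G}^Y_N(i,j) \\ \mathbf{A}^Y_N(i,j) \end{bmatrix} , \begin{bmatrix} \mathbf{c}^Y_N(i,j) \\ - \mathbf{b}^Y_N(i,j) \end{bmatrix} \right\} \] (a zonotope in generator–center form) for all $i,j \in \mathbb{I}$, $i \neq j$, where $\mathbf{N}(i,j) = \mathbf{F}^{[j]} \bar{\mathbf{H}}^{[j]} - \mathbf{F}^{[i]} \bar{\mathbf{H}}^{[i]} + [\mathbf{0} \;\; (\mathbf{D}^{[j]}-\mathbf{D}^{[i]})]$, $\boldsymbol{\Omega}(i,j) = [(\boldsymbol{\Omega}_N^{[i]})^T \; \mathbf{0} \; (\boldsymbol{\Omega}_N^{[j]})^T \; \mathbf{0}]^T$, and $\mathbf{G}^Y_N(i,j) = [ \mathbf{G}^{Y[i]}_N \;\; -\mathbf{G}^{Y[j]}_N ]$, $\mathbf{c}^Y_N(i,j) = \mathbf{c}^{Y[i]}_N(\bar{\mathbf{0}}) - \mathbf{c}^{Y[j]}_N(\bar{\mathbf{0}})$, $\mathbf{A}^Y_N(i,j)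 = \mathrm{blkdiag}(\mathbf{A}_N^{Y[i]}, \mathbf{A}_N^{Y[j]})$, $\mathbf{b}^Y_N(i,j) = [(\mathbf{b}_N^{Y[i]}(\bar{\mathbf{0}}))^T \;\; (\mathbf{b}_N^{Y[j]}(\bar{\mathbf{0}}))^T]^T$, with $\bar{\mathbf{0}}$ the zero input sequence.
   Context: Constrained zonotope notation: $\{\mathbf{G},\mathbf{c},\mathbf{A},\mathbf{b}\} = \{\mathbf{c}+\mathbf{G}\boldsymbol{\xi} : \|\boldsymbol{\xi}\|_\infty\le1,\ \mathbf{A}\boldsymbol{\xi}=\mathbf{b}\}$; a zonotope is $\{\mathbf{G},\mathbf{c}\}$. Consider $n_m$ linear descriptor models $i \in \mathbb{I} = \{1,\ldots,n_m\}$: $\mathbf{E}^{[i]}\mathbf{x}_k = \mathbf{A}^{[i]}\mathbf{x}_{k-1} + \mathbf{B}^{[i]}\mathbf{u}_{k-1} + \mathbf{B}_w^{[i]}\mathbf{w}_{k-1}$, $\mathbf{y}_k = \mathbf{C}^{[i]}\mathbf{x}_k + \mathbf{D}^{[i]}\mathbf{u}_k + \mathbf{D}_v^{[i]}\mathbf{v}_k$, with $\mathbf{x}_0 \in X_0$, $\mathbf{w}_k \in W$, $\mathbf{v}_k \in V = \{\mathbf{G}_v,\mathbf{c}_v,\mathbf{A}_v,\mathbf{b}_v\}$, $\mathbf{u}_k \in U$, $\bar{U} = U\times\cdots\times U$. For each $i$, with SVD $\mathbf{E}^{[i]} = \mathbf{U}^{[i]}\boldsymbol{\Sigma}^{[i]}(\mathbf{V}^{[i]})^T$,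 $\boldsymbol{\Sigma}^{[i]} = \mathrm{blkdiag}(\tilde{\boldsymbol{\Sigma}}^{[i]},\mathbf{0})$, $\mathbf{T}^{[i]} = ((\mathbf{V}^{[i]})^T)^{-1}$, define $[\tilde{\mathbf{A}}^{[i]};\check{\mathbf{A}}^{[i]}] = \mathrm{blkdiag}((\tilde{\boldsymbol{\Sigma}}^{[i]})^{-1},\mathbf{I})(\mathbf{U}^{[i]})^{-1}\mathbf{A}^{[i]}\mathbf{T}^{[i]}$, and analogously $\tilde{\mathbf{B}}^{[i]},\check{\mathbf{B}}^{[i]}$ from $\mathbf{B}^{[i]}$ and $\tilde{\mathbf{B}}_w^{[i]},\check{\mathbf{B}}_w^{[i]}$ from $\mathbf{B}_w^{[i]}$ (without right-multiplying by $\mathbf{T}^{[i]}$). With $\mathbf{z}_k = (\tilde{\mathbf{z}}_k,\check{\mathbf{z}}_k) = ((\mathbf{T}^{[i]})^{-1}\mathbf{x}_k,\mathbf{w}_k)$, the models become $\tilde{\mathbf{z}}_k = \tilde{\mathbf{A}}_z^{[i]}\mathbf{z}_{k-1} + \tilde{\mathbf{B}}^{[i]}\mathbf{u}_{k-1}$, $\mathbf{0} = \check{\mathbf{A}}_z^{[i]}\mathbf{z}_k + \check{\mathbf{B}}^{[i]}\mathbf{u}_k$, $\mathbf{y}_k = \mathbf{F}^{[i]}\mathbf{z}_k + \mathbf{D}^{[i]}\mathbf{u}_k + \mathbf{D}_v^{[i]}\mathbf{v}_k$, where $\tilde{\mathbf{A}}_z^{[i]} = [\tilde{\mathbf{A}}^{[i]}\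 \tilde{\mathbf{B}}_w^{[i]}]$, $\check{\mathbf{A}}_z^{[i]} = [\check{\mathbf{A}}^{[i]}\ \check{\mathbf{B}}_w^{[i]}]$, $\mathbf{F}^{[i]} = \mathbf{C}^{[i]}\mathbf{T}^{[i]}[\mathbf{I}_n\ \mathbf{0}]$. A known constrained zonotope $X_a$ satisfies $\mathbf{x}_k\in X_a$ for all $k$; $Z_a^{[i]} = (\mathbf{T}^{[i]})^{-1}X_a\times W = \{\mathbf{G}_a^{[i]},\mathbf{c}_a^{[i]},\mathbf{A}_a^{[i]},\mathbf{b}_a^{[i]}\}$ with $\check{\mathbf{c}}_a^{[i]},\check{\mathbf{G}}_a^{[i]}$ the rows corresponding to $\check{\mathbf{z}}$; $\{\mathbf{G}_z^{[i]},\mathbf{c}_z^{[i]},\mathbf{A}_z^{[i]},\mathbf{b}_z^{[i]}\} = (\mathbf{T}^{[i]})^{-1}X_0\times W$. The state reachable set is $Z_N^{[i]}(\bar{\mathbf{u}}) = \{\mathbf{G}_N^{[i]},\mathbf{c}_N^{[i]}(\bar{\mathbf{u}}),\mathbf{A}_N^{[i]},\mathbf{b}_N^{[i]}(\bar{\mathbf{u}})\}$ given by the recursion, for $k=1,\ldots,N$: $\mathbf{c}_k^{[i]} = [\tilde{\mathbf{A}}_z^{[i]}\mathbf{c}_{k-1}^{[i]} + \tilde{\mathbf{B}}^{[i]}\mathbf{u}_{k-1};\ \check{\mathbf{c}}_a^{[i]}]$, $\mathbf{G}_k^{[i]} = \begin{bmatrix}\tilde{\mathbf{A}}_z^{[i]}\mathbf{G}_{k-1}^{[i]}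 & \mathbf{0}\\ \mathbf{0} & \check{\mathbf{G}}_a^{[i]}\end{bmatrix}$, $\mathbf{A}_k^{[i]} = \begin{bmatrix}\mathrm{blkdiag}(\mathbf{A}_{k-1}^{[i]},\mathbf{A}_a^{[i]}) \\ \check{\mathbf{A}}_z^{[i]}\mathbf{G}_k^{[i]}\end{bmatrix}$, $\mathbf{b}_k^{[i]} = [\mathbf{b}_{k-1}^{[i]};\ \mathbf{b}_a^{[i]};\ -\check{\mathbf{A}}_z^{[i]}\mathbf{c}_k^{[i]} - \check{\mathbf{B}}^{[i]}\mathbf{u}_k]$, initialized with $\mathbf{G}_0^{[i]} = \mathbf{G}_z^{[i]}$, $\mathbf{c}_0^{[i]} = \mathbf{c}_z^{[i]}$, $\mathbf{A}_0^{[i]} = [\mathbf{A}_z^{[i]};\ \check{\mathbf{A}}_z^{[i]}\mathbf{G}_0^{[i]}]$, $\mathbf{b}_0^{[i]} = [\mathbf{b}_z^{[i]};\ -\check{\mathbf{A}}_z^{[i]}\mathbf{c}_0^{[i]} - \check{\mathbf{B}}^{[i]}\mathbf{u}_0]$. These are affine in $\bar{\mathbf{u}}$: $\mathbf{c}_N^{[i]}(\bar{\mathbf{u}}) = \mathbf{c}_N^{[i]}(\bar{\mathbf{0}}) + \mathbf{H}_N^{[i]}\bar{\mathbf{u}}$ and $\mathbf{b}_N^{[i]}(\bar{\mathbf{u}}) = \mathbf{b}_N^{[i]}(\bar{\mathbf{0}}) + \boldsymbol{\Omega}_N^{[i]}\bar{\mathbf{u}}$, where $\mathbf{H}_h^{[i]}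 = [\ \cdots\ \mathbf{M}^{h-m}[\tilde{\mathbf{B}}^{[i]};\mathbf{0}]\ \cdots\ \mathbf{0}\ \cdots]$ ($m=1,\ldots,h$, followed by $N-h+1$ zero blocks), $\mathbf{M} = [\tilde{\mathbf{A}}_z^{[i]};\mathbf{0}]$, $\mathbf{H}_0^{[i]} = \mathbf{0}$, $\bar{\mathbf{H}}^{[i]} = [(\mathbf{H}_0^{[i]})^T\ \cdots\ (\mathbf{H}_N^{[i]})^T]^T$, $\boldsymbol{\Omega}_N^{[i]} = \boldsymbol{\Gamma}_N^{[i]} + \boldsymbol{\Upsilon}_N^{[i]}\bar{\mathbf{H}}^{[i]}$, $\boldsymbol{\Upsilon}_N^{[i]} = \mathrm{blkdiag}([\mathbf{0};-\check{\mathbf{A}}_z^{[i]}],\ldots)$, $\boldsymbol{\Gamma}_N^{[i]} = \mathrm{blkdiag}([\mathbf{0};-\check{\mathbf{B}}^{[i]}],\ldots)$ ($N+1$ blocks each). The output reachable set is $Y_N^{[i]}(\bar{\mathbf{u}}) = \mathbf{F}^{[i]}Z_N^{[i]}(\bar{\mathbf{u}}) \oplus \mathbf{D}^{[i]}\mathbf{u}_N \oplus \mathbf{D}_v^{[i]}V = \{\mathbf{G}_N^{Y[i]},\mathbf{c}_N^{Y[i]}(\bar{\mathbf{u}}),\mathbf{A}_N^{Y[i]},\mathbf{b}_N^{Y[i]}(\bar{\mathbf{u}})\}$ with $\mathbf{c}_N^{Y[i]} = \mathbf{F}^{[i]}\mathbf{c}_N^{[i]}(\bar{\mathbf{u}})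 + \mathbf{D}^{[i]}\mathbf{u}_N + \mathbf{D}_v^{[i]}\mathbf{c}_v$, $\mathbf{G}_N^{Y[i]} = [\mathbf{F}^{[i]}\mathbf{G}_N^{[i]}\ \mathbf{G}_v]$, $\mathbf{A}_N^{Y[i]} = \mathrm{blkdiag}(\mathbf{A}_N^{[i]},\mathbf{A}_v)$, $\mathbf{b}_N^{Y[i]} = [\mathbf{b}_N^{[i]}(\bar{\mathbf{u}});\ \mathbf{b}_v]$. In $\mathbf{N}(i,j)$ the block $[\mathbf{0}\ (\mathbf{D}^{[j]}-\mathbf{D}^{[i]})]$ acts on the last input $\mathbf{u}_N$; the zero blocks in $\boldsymbol{\Omega}(i,j)$ correspond to the $\mathbf{b}_v$ rows. *)

theory Defs
  imports "Jordan_Normal_Form.Matrix"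
begin

section \<open>Block-matrix helpers\<close>

text \<open>Horizontal concatenation [A B] (A, B with the same number of rows).\<close>
definition hcat :: "real mat \<Rightarrow> real mat \<Rightarrow> real mat" where
  "hcat A B = four_block_mat A B (0\<^sub>m 0 (dim_col A)) (0\<^sub>m 0 (dim_col B))"

text \<open>Block diagonal blkdiag(A,B).\<close>
definition blkdiag :: "real mat \<Rightarrow> real mat \<Rightarrow> real mat" where
  "blkdiag A B = diag_block_mat [A, B]"

text \<open>[M_0 M_1 ... M_k] with nr rows, and [M_0; M_1; ...; M_k] with nc columns.\<close>
definition hcat_list :: "nat \<Rightarrow> real mat list \<Rightarrow> real mat" where
  "hcat_list nr Ms = foldr hcat Ms (0\<^sub>m nr 0)"

definition vcat_list :: "nat \<Rightarrow> real mat list \<Rightarrow> real mat" where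
  "vcat_list nc Ms = foldr (\<lambda>A B. A @\<^sub>r B) Ms (0\<^sub>m 0 nc)"

section \<open>Constrained zonotopes and zonotopes\<close>

text \<open>{G,c,A,b} = {c + G xi : ||xi||_inf \<le> 1, A xi = b}\<close>
definition czono :: "real mat \<Rightarrow> real vec \<Rightarrow> real mat \<Rightarrow> real vec \<Rightarrow> real vec set" where
  "czono G c A b = {c + G *\<^sub>v \<xi> | \<xi>. \<xi> \<in> carrier_vec (dim_col G) \<and>
       (\<forall>t < dim_col G. \<bar>\<xi> $ t\<bar> \<le> 1) \<and> A *\<^sub>v \<xi> = b}"

text \<open>{G,c} = {c + G xi : ||xi||_inf \<le> 1}\<close>
definition zono :: "real mat \<Rightarrow> real vec \<Rightarrow> real vec set" where
  "zono G c = {c + G *\<^sub>v \<xi> | \<xi>. \<xi> \<in> carrier_vec (dim_col G) \<and>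
       (\<forall>t < dim_col G. \<bar>\<xi> $ t\<bar> \<le> 1)}"

section \<open>Transformed descriptor models\<close>

text \<open>Data of model i after the SVD-based transformation (see NOTES.md):
  At = tilde A_z, Ac = check A_z, Bt = tilde B, Bc = check B, F, D, D_v,
  (Gz,cz,Az,bz) = T^{-1} X_0 \<times> W, (Ga,ca,Aa,ba) = Z_a = T^{-1} X_a \<times> W.\<close>
record dmodel =
  At :: "real mat"
  Ac :: "real mat"
  Bt :: "real mat"
  Bc :: "real mat"
  Fm :: "real mat"
  Dm :: "real mat"
  Dvm :: "real mat"
  Gz :: "real mat"
  cz :: "real vec"
  Az :: "real mat"
  bz :: "real vec"
  Ga :: "real mat"
  ca :: "real vec"
  Aa :: "real mat"
  ba :: "real vec"

text \<open>Consistent dimensions: n state, nw disturbance, nz = n + nw, r algebraic rows,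
  nu inputs, ny outputs, nv = dimension of the noise set V.\<close>
definition wf_model :: "nat \<Rightarrow> nat \<Rightarrow> nat \<Rightarrow> dmodel \<Rightarrow> bool" where
  "wf_model ny nu nv m \<longleftrightarrow> (\<exists>n nw r gz qz ga qa.
     At m \<in> carrier_mat n (n + nw) \<and> Ac m \<in> carrier_mat r (n + nw) \<and>
     Bt m \<in> carrier_mat n nu \<and> Bc m \<in> carrier_mat r nu \<and>
     Fm m \<in> carrier_mat ny (n + nw) \<and> Dm m \<in> carrier_mat ny nu \<and> Dvm m \<in> carrier_mat ny nv \<and>
     Gz m \<in> carrier_mat (n + nw) gz \<and> cz m \<in> carrier_vec (n + nw) \<and>
     Az m \<in> carrier_mat qz gz \<and> bz m \<in> carrier_vec qz \<and>
     Ga m \<in> carrier_mat (n + nw) ga \<and> ca m \<in> carrier_vec (n + nw) \<and>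
     Aa m \<in> carrier_mat qa ga \<and> ba m \<in> carrier_vec qa)"

text \<open>Rows of Z_a corresponding to the check z component (rows n, ..., n+nw-1).\<close>
definition Gac :: "dmodel \<Rightarrow> real mat" where
  "Gac m = mat (dim_row (Ga m) - dim_row (At m)) (dim_col (Ga m))
              (\<lambda>(a,b). Ga m $$ (a + dim_row (At m), b))"

definition cac :: "dmodel \<Rightarrow> real vec" where
  "cac m = vec (dim_vec (ca m) - dim_row (At m)) (\<lambda>a. ca m $ (a + dim_row (At m)))"

section \<open>Input sequences\<close>

text \<open>ubar = (u_0, ..., u_N) stacked in a vector of dimension (N+1) nu; u_k is the k-th block.\<close>
definition useq :: "nat \<Rightarrow> real vec \<Rightarrow> nat \<Rightarrow> real vec" where
  "useq nu ubar k = vec nu (\<lambda>t. ubar $ (k * nu + t))"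

definition Ubar :: "nat \<Rightarrow> nat \<Rightarrow> real vec set \<Rightarrow> real vec set" where
  "Ubar N nu U = {ubar. ubar \<in> carrier_vec ((N + 1) * nu) \<and> (\<forall>k \<le> N. useq nu ubar k \<in> U)}"

section \<open>State reachable set recursion\<close>

text \<open>czrec m u k = (G_k, c_k, A_k, b_k) for the input sequence k \<mapsto> u k.\<close>
fun czrec :: "dmodel \<Rightarrow> (nat \<Rightarrow> real vec) \<Rightarrow> nat \<Rightarrow> real mat \<times> real vec \<times> real mat \<times> real vec" where
  "czrec m u 0 =
     (Gz m, cz m, Az m @\<^sub>r (Ac m * Gz m), bz m @\<^sub>v (- (Ac m *\<^sub>v cz m) - Bc m *\<^sub>v u 0))"
| "czrec m u (Suc k) =
     (let (G, c, A, b) = czrec m u k;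
          c' = (At m *\<^sub>v c + Bt m *\<^sub>v u k) @\<^sub>v cac m;
          G' = blkdiag (At m * G) (Gac m);
          A' = blkdiag A (Aa m) @\<^sub>r (Ac m * G');
          b' = b @\<^sub>v ba m @\<^sub>v (- (Ac m *\<^sub>v c') - Bc m *\<^sub>v u (Suc k))
      in (G', c', A', b'))"

definition GN :: "dmodel \<Rightarrow> nat \<Rightarrow> nat \<Rightarrow> real vec \<Rightarrow> real mat" where
  "GN m N nu ubar = fst (czrec m (useq nu ubar) N)"
definition cN :: "dmodel \<Rightarrow> nat \<Rightarrow> nat \<Rightarrow> real vec \<Rightarrow> real vec" where
  "cN m N nu ubar = fst (snd (czrec m (useq nu ubar) N))"
definition AN :: "dmodel \<Rightarrow> nat \<Rightarrow> nat \<Rightarrow> real vec \<Rightarrow> real mat" where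
  "AN m N nu ubar = fst (snd (snd (czrec m (useq nu ubar) N)))"
definition bN :: "dmodel \<Rightarrow> nat \<Rightarrow> nat \<Rightarrow> real vec \<Rightarrow> real vec" where
  "bN m N nu ubar = snd (snd (snd (czrec m (useq nu ubar) N)))"

text \<open>Z_N(ubar)\<close>
definition ZN :: "dmodel \<Rightarrow> nat \<Rightarrow> nat \<Rightarrow> real vec \<Rightarrow> real vec set" where
  "ZN m N nu ubar = czono (GN m N nu ubar) (cN m N nu ubar) (AN m N nu ubar) (bN m N nu ubar)"

text \<open>Output reachable set Y_N(ubar) = F Z_N(ubar) \<oplus> D u_N \<oplus> D_v V, V = {Gv,cv,Av,bv}.\<close>
definition YN :: "dmodel \<Rightarrow> nat \<Rightarrow> nat \<Rightarrow> real mat \<Rightarrow> real vec \<Rightarrow> real mat \<Rightarrow> real vec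
                  \<Rightarrow> real vec \<Rightarrow> real vec set" where
  "YN m N nu Gv cv Av bv ubar =
     {Fm m *\<^sub>v z + Dm m *\<^sub>v useq nu ubar N + Dvm m *\<^sub>v v | z v.
        z \<in> ZN m N nu ubar \<and> v \<in> czono Gv cv Av bv}"

section \<open>Constrained-zonotope data of Y_N at the zero input\<close>

definition zero_seq :: "nat \<Rightarrow> nat \<Rightarrow> real vec" where
  "zero_seq N nu = 0\<^sub>v ((N + 1) * nu)"

definition GYN :: "dmodel \<Rightarrow> nat \<Rightarrow> nat \<Rightarrow> real mat \<Rightarrow> real mat" where
  "GYN m N nu Gv = hcat (Fm m * GN m N nu (zero_seq N nu)) (Dvm m * Gv)"
definition cYN0 :: "dmodel \<Rightarrow> nat \<Rightarrow> nat \<Rightarrow> real vec \<Rightarrow> real vec" where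
  "cYN0 m N nu cv = Fm m *\<^sub>v cN m N nu (zero_seq N nu) + Dm m *\<^sub>v 0\<^sub>v nu + Dvm m *\<^sub>v cv"
definition AYN :: "dmodel \<Rightarrow> nat \<Rightarrow> nat \<Rightarrow> real mat \<Rightarrow> real mat" where
  "AYN m N nu Av = blkdiag (AN m N nu (zero_seq N nu)) Av"
definition bYN0 :: "dmodel \<Rightarrow> nat \<Rightarrow> nat \<Rightarrow> real vec \<Rightarrow> real vec" where
  "bYN0 m N nu bv = bN m N nu (zero_seq N nu) @\<^sub>v bv"

section \<open>The matrices H_h, bar H, Upsilon_N, Gamma_N, Omega_N\<close>

text \<open>M = [tilde A_z; 0] (nz \<times> nz), and [tilde B; 0] (nz \<times> nu).\<close>
definition Mmat :: "dmodel \<Rightarrow> real mat" where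
  "Mmat m = At m @\<^sub>r 0\<^sub>m (dim_col (At m) - dim_row (At m)) (dim_col (At m))"
definition Bt0 :: "dmodel \<Rightarrow> real mat" where
  "Bt0 m = Bt m @\<^sub>r 0\<^sub>m (dim_col (At m) - dim_row (At m)) (dim_col (Bt m))"

text \<open>H_h = [M^(h-1)[B;0] ... M^0[B;0] 0 ... 0] with N+1 blocks (block k acts on u_k).\<close>
definition Hmat :: "dmodel \<Rightarrow> nat \<Rightarrow> nat \<Rightarrow> nat \<Rightarrow> real mat" where
  "Hmat m N nu h = hcat_list (dim_col (At m))
     (map (\<lambda>k. if k < h then (Mmat m ^\<^sub>m (h - Suc k)) * Bt0 m
               else 0\<^sub>m (dim_col (At m)) nu) [0..<N + 1])"

definition Hbar :: "dmodel \<Rightarrow> nat \<Rightarrow> nat \<Rightarrow> real mat" where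
  "Hbar m N nu = vcat_list ((N + 1) * nu) (map (Hmat m N nu) [0..<N + 1])"

text \<open>Upsilon_N = blkdiag([0;-check A_z], ...), Gamma_N = blkdiag([0;-check B], ...), N+1 blocks;
  the zero blocks have as many rows as b_z (first block) resp. b_a (other blocks).\<close>
definition Upsilon :: "dmodel \<Rightarrow> nat \<Rightarrow> real mat" where
  "Upsilon m N = diag_block_mat
     (map (\<lambda>k. 0\<^sub>m (if k = 0 then dim_vec (bz m) else dim_vec (ba m)) (dim_col (Ac m)) @\<^sub>r (- Ac m))
          [0..<N + 1])"
definition Gamma :: "dmodel \<Rightarrow> nat \<Rightarrow> real mat" where
  "Gamma m N = diag_block_mat
     (map (\<lambda>k. 0\<^sub>m (if k = 0 then dim_vec (bz m) else dim_vec (ba m)) (dim_col (Bc m)) @\<^sub>r (- Bc m))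
          [0..<N + 1])"

definition OmegaN :: "dmodel \<Rightarrow> nat \<Rightarrow> nat \<Rightarrow> real mat" where
  "OmegaN m N nu = Gamma m N + Upsilon m N * Hbar m N nu"

section \<open>The pairwise objects N(i,j), Omega(i,j), Y(i,j)\<close>

definition Nij :: "dmodel \<Rightarrow> dmodel \<Rightarrow> nat \<Rightarrow> nat \<Rightarrow> real mat" where
  "Nij mi mj N nu = Fm mj * Hmat mj N nu N - Fm mi * Hmat mi N nu N
       + hcat (0\<^sub>m (dim_row (Dm mi)) (N * nu)) (Dm mj - Dm mi)"

definition Omegaij :: "dmodel \<Rightarrow> dmodel \<Rightarrow> nat \<Rightarrow> nat \<Rightarrow> real vec \<Rightarrow> real mat" where
  "Omegaij mi mj N nu bv = OmegaN mi N nu @\<^sub>r 0\<^sub>m (dim_vec bv) ((N + 1) * nu)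
       @\<^sub>r OmegaN mj N nu @\<^sub>r 0\<^sub>m (dim_vec bv) ((N + 1) * nu)"

definition GYij :: "dmodel \<Rightarrow> dmodel \<Rightarrow> nat \<Rightarrow> nat \<Rightarrow> real mat \<Rightarrow> real mat" where
  "GYij mi mj N nu Gv = hcat (GYN mi N nu Gv) (- GYN mj N nu Gv)"
definition cYij :: "dmodel \<Rightarrow> dmodel \<Rightarrow> nat \<Rightarrow> nat \<Rightarrow> real vec \<Rightarrow> real vec" where
  "cYij mi mj N nu cv = cYN0 mi N nu cv - cYN0 mj N nu cv"
definition AYij :: "dmodel \<Rightarrow> dmodel \<Rightarrow> nat \<Rightarrow> nat \<Rightarrow> real mat \<Rightarrow> real mat" where
  "AYij mi mj N nu Av = blkdiag (AYN mi N nu Av) (AYN mj N nu Av)"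
definition bYij :: "dmodel \<Rightarrow> dmodel \<Rightarrow> nat \<Rightarrow> nat \<Rightarrow> real vec \<Rightarrow> real vec" where
  "bYij mi mj N nu bv = bYN0 mi N nu bv @\<^sub>v bYN0 mj N nu bv"

text \<open>mathcal Y(i,j) = { [G^Y(i,j); A^Y(i,j)], [c^Y(i,j); -b^Y(i,j)] } (a zonotope).\<close>
definition Yij :: "dmodel \<Rightarrow> dmodel \<Rightarrow> nat \<Rightarrow> nat \<Rightarrow> real mat \<Rightarrow> real vec \<Rightarrow> real mat
                   \<Rightarrow> real vec \<Rightarrow> real vec set" where
  "Yij mi mj N nu Gv cv Av bv =
     zono (GYij mi mj N nu Gv @\<^sub>r AYij mi mj N nu Av) (cYij mi mj N nu cv @\<^sub>v (- bYij mi mj N nu bv))"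

end

theory Submission
  imports Defs
begin

text \<open>The input \<open>u\<close> enters the state reachable set \<open>Z\<^sub>N(u) = {G\<^sub>N, c\<^sub>N(u), A\<^sub>N, b\<^sub>N(u)}\<close>
  only through the centre and the right-hand side of the constraints, and affinely so:
  \<open>c\<^sub>N(u) = c\<^sub>N(0) + H\<^sub>N u\<close> and \<open>b\<^sub>N(u) = b\<^sub>N(0) + \<Omega>\<^sub>N u\<close>, while \<open>G\<^sub>N\<close> and \<open>A\<^sub>N\<close> do not
  depend on \<open>u\<close>. Hence every output reachable set \<open>Y\<^sub>N(u)\<close> is the constrained zonotope
  \<open>Y\<^sub>N(0)\<close> with centre and right-hand side shifted linearly in \<open>u\<close>. Two constrained zonotopes
  \<open>{G\<^sub>1, c\<^sub>1, A\<^sub>1, b\<^sub>1}\<close> and \<open>{G\<^sub>2, c\<^sub>2, A\<^sub>2, b\<^sub>2}\<close> meet iff there are \<open>\<xi>\<^sub>1, \<xi>\<^sub>2\<close> in the unit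
  box with \<open>c\<^sub>1 + G\<^sub>1 \<xi>\<^sub>1 = c\<^sub>2 + G\<^sub>2 \<xi>\<^sub>2\<close> and \<open>A\<^sub>i \<xi>\<^sub>i = b\<^sub>i\<close>; collecting the terms that depend
  on \<open>u\<close> on one side turns this into membership of \<open>[N(i,j); \<Omega>(i,j)] u\<close> in the zonotope
  \<open>Yij\<close> with generators \<open>[G\<^sub>1 -G\<^sub>2; blkdiag(A\<^sub>1, A\<^sub>2)]\<close>.\<close>

section \<open>Block vectors and matrices\<close>

lemma append_vec_empty: "dim_vec w = 0 \<Longrightarrow> v @\<^sub>v w = v"
  by (rule eq_vecI) auto

lemma append_vec_assoc: "(a @\<^sub>v b) @\<^sub>v c = a @\<^sub>v b @\<^sub>v c"
proof (rule eq_vecI)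
  fix i assume "i < dim_vec (a @\<^sub>v b @\<^sub>v c)"
  then show "((a @\<^sub>v b) @\<^sub>v c) $ i = (a @\<^sub>v b @\<^sub>v c) $ i"
    by (cases "i < dim_vec a"; cases "i < dim_vec a + dim_vec b") auto
qed auto

lemma uminus_append_vec: "- (a @\<^sub>v b) = (- a) @\<^sub>v (- b)"
proof (rule eq_vecI)
  fix i assume "i < dim_vec ((- a) @\<^sub>v (- b))"
  then show "(- (a @\<^sub>v b)) $ i = ((- a) @\<^sub>v (- b)) $ i"
    by (cases "i < dim_vec a") auto
qed auto

lemma zero_mat_mult_vec [simp]: "dim_vec v = nc \<Longrightarrow> 0\<^sub>m nr nc *\<^sub>v v = 0\<^sub>v nr"
  by (rule eq_vecI) (auto simp: scalar_prod_def)

lemma mult_zero_vec [simp]: "dim_col A = n \<Longrightarrow> A *\<^sub>v 0\<^sub>v n = 0\<^sub>v (dim_row A)"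
  by (rule eq_vecI) (auto simp: scalar_prod_def)

lemma pow_mat_Suc_left: "M \<in> carrier_mat n n \<Longrightarrow> M ^\<^sub>m Suc k = M * M ^\<^sub>m k"
proof (induction k)
  case (Suc k)
  have "M ^\<^sub>m Suc (Suc k) = (M * M ^\<^sub>m k) * M" using Suc by simp
  also have "\<dots> = M * (M ^\<^sub>m k * M)" by (rule assoc_mult_mat) (use Suc.prems in auto)
  finally show ?case by simp
qed simp

lemma blkdiag_eq_four_block_mat:
  "blkdiag A B = four_block_mat A (0\<^sub>m (dim_row A) (dim_col B)) (0\<^sub>m (dim_row B) (dim_col A)) B"
  unfolding blkdiag_def diag_block_mat.simps(2)[of A "[B]"] diag_block_mat_singleton Let_def ..

lemma blkdiag_carrier:
  "A \<in> carrier_mat nr1 nc1 \<Longrightarrow> B \<in> carrier_mat nr2 nc2 \<Longrightarrow>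
   blkdiag A B \<in> carrier_mat (nr1 + nr2) (nc1 + nc2)"
  unfolding blkdiag_eq_four_block_mat by auto

lemma blkdiag_mult_append_vec:
  assumes "A \<in> carrier_mat nr1 nc1" "B \<in> carrier_mat nr2 nc2"
    and "x \<in> carrier_vec nc1" "y \<in> carrier_vec nc2"
  shows "blkdiag A B *\<^sub>v (x @\<^sub>v y) = (A *\<^sub>v x) @\<^sub>v (B *\<^sub>v y)"
  unfolding blkdiag_eq_four_block_mat using assms
  by (subst four_block_mat_mult_vec[of A nr1 nc1 _ nc2 _ nr2]) auto

lemma hcat_carrier:
  "A \<in> carrier_mat nr nc1 \<Longrightarrow> B \<in> carrier_mat nr nc2 \<Longrightarrow> hcat A B \<in> carrier_mat nr (nc1 + nc2)"
  unfolding hcat_def by auto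

lemma hcat_mult_append_vec:
  assumes "A \<in> carrier_mat nr nc1" "B \<in> carrier_mat nr nc2"
    and "x \<in> carrier_vec nc1" "y \<in> carrier_vec nc2"
  shows "hcat A B *\<^sub>v (x @\<^sub>v y) = A *\<^sub>v x + B *\<^sub>v y"
  unfolding hcat_def using assms
  by (subst four_block_mat_mult_vec[of A nr nc1 _ nc2 _ 0]) (auto intro!: append_vec_empty)

definition vconcat :: "real vec list \<Rightarrow> real vec" where
  "vconcat vs = foldr (@\<^sub>v) vs (0\<^sub>v 0)"

lemma vconcat_simps [simp]: "vconcat [] = 0\<^sub>v 0" "vconcat (v # vs) = v @\<^sub>v vconcat vs"
  unfolding vconcat_def by auto

lemma vconcat_append: "vconcat (xs @ ys) = vconcat xs @\<^sub>v vconcat ys"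
  by (induction xs) (auto simp: append_vec_assoc append_vec_empty)

lemma vconcat_single: "vconcat [x] = x"
  by (simp add: append_vec_empty)

lemma dim_vconcat: "dim_vec (vconcat vs) = sum_list (map dim_vec vs)"
  by (induction vs) auto

lemma vconcat_add:
  "(\<And>j. j \<in> set xs \<Longrightarrow> dim_vec (f j) = dim_vec (g j)) \<Longrightarrow>
   vconcat (map f xs) + vconcat (map g xs) = vconcat (map (\<lambda>j. f j + g j) xs)"
proof (induction xs)
  case (Cons x xs)
  have dims: "dim_vec (vconcat (map f xs)) = dim_vec (vconcat (map g xs))"
    using Cons.prems unfolding dim_vconcat by (induction xs) auto
  have "vconcat (map f (x # xs)) + vconcat (map g (x # xs))
      = (f x + g x) @\<^sub>v (vconcat (map f xs) + vconcat (map g xs))"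
    using Cons.prems dims
    by (simp, subst append_vec_add[of _ "dim_vec (f x)" _ _ "dim_vec (vconcat (map f xs))"])
       (auto intro: carrier_vecI)
  then show ?case using Cons by simp
qed (auto intro!: eq_vecI)

lemma map2_map_map: "map2 f (map g xs) (map h xs) = map (\<lambda>x. f (g x) (h x)) xs"
  by (induction xs) auto

lemma mult_diag_block_mat_vconcat:
  "length Ms = length vs \<Longrightarrow> (\<And>i. i < length Ms \<Longrightarrow> dim_vec (vs ! i) = dim_col (Ms ! i)) \<Longrightarrow>
   diag_block_mat Ms *\<^sub>v vconcat vs = vconcat (map2 (*\<^sub>v) Ms vs)"
proof (induction Ms arbitrary: vs)
  case (Cons M Ms)
  then obtain v vs' where vs: "vs = v # vs'" by (cases vs) auto
  let ?D = "diag_block_mat Ms"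
  have dims: "\<And>i. i < length Ms \<Longrightarrow> dim_vec (vs' ! i) = dim_col (Ms ! i)"
    using Cons.prems(2)[of "Suc _"] by (auto simp: vs)
  have v: "v \<in> carrier_vec (dim_col M)"
    using Cons.prems(2)[of 0] by (auto simp: vs intro: carrier_vecI)
  have "dim_vec (vconcat vs') = dim_col ?D"
    using Cons.prems(1) dims unfolding vs dim_vconcat dim_diag_block_mat
    by (auto intro!: arg_cong[of _ _ sum_list] nth_equalityI)
  then have w: "vconcat vs' \<in> carrier_vec (dim_col ?D)" by (rule carrier_vecI)
  have "diag_block_mat (M # Ms) *\<^sub>v vconcat (v # vs') =
     (M *\<^sub>v v + 0\<^sub>m (dim_row M) (dim_col ?D) *\<^sub>v vconcat vs') @\<^sub>v
     (0\<^sub>m (dim_row ?D) (dim_col M) *\<^sub>v v + ?D *\<^sub>v vconcat vs')"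
    unfolding diag_block_mat.simps Let_def vconcat_simps
    by (rule four_block_mat_mult_vec[OF _ _ _ _ v w]) auto
  also have "\<dots> = (M *\<^sub>v v) @\<^sub>v (?D *\<^sub>v vconcat vs')"
    using v w mult_mat_vec_carrier[of M "dim_row M" "dim_col M" v]
      mult_mat_vec_carrier[of ?D "dim_row ?D" "dim_col ?D" "vconcat vs'"] by simp
  finally show ?case
    using Cons.IH[of vs'] Cons.prems(1) dims by (simp add: vs)
qed (auto intro!: eq_vecI)

lemma vcat_list_carrier:
  "(\<And>M. M \<in> set Ms \<Longrightarrow> dim_col M = nc) \<Longrightarrow>
   vcat_list nc Ms \<in> carrier_mat (sum_list (map dim_row Ms)) nc"
  unfolding vcat_list_def by (induction Ms) auto

lemma mult_vcat_list:
  "(\<And>M. M \<in> set Ms \<Longrightarrow> dim_col M = nc) \<Longrightarrow> v \<in> carrier_vec nc \<Longrightarrow>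
   vcat_list nc Ms *\<^sub>v v = vconcat (map (\<lambda>M. M *\<^sub>v v) Ms)"
proof (induction Ms)
  case (Cons M Ms)
  have "vcat_list nc Ms \<in> carrier_mat (sum_list (map dim_row Ms)) nc"
    using Cons.prems by (intro vcat_list_carrier) auto
  moreover have "M \<in> carrier_mat (dim_row M) nc"
    using Cons.prems(1) by (intro carrier_matI) auto
  ultimately show ?case
    using Cons by (simp add: vcat_list_def mat_mult_append)
qed (auto simp: vcat_list_def intro!: eq_vecI)

lemma hcat_list_carrier:
  "(\<And>M. M \<in> set Ms \<Longrightarrow> dim_row M = nr) \<Longrightarrow>
   hcat_list nr Ms \<in> carrier_mat nr (sum_list (map dim_col Ms))"
proof (induction Ms)
  case (Cons M Ms)
  have M: "M \<in> carrier_mat nr (dim_col M)" using Cons.prems by (intro carrier_matI) auto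
  have "hcat_list nr Ms \<in> carrier_mat nr (sum_list (map dim_col Ms))" using Cons by simp
  from hcat_carrier[OF M this] show ?case by (simp add: hcat_list_def)
qed (auto simp: hcat_list_def)

lemma mult_hcat_list_vconcat:
  "(\<And>k. k \<in> set xs \<Longrightarrow> f k \<in> carrier_mat nr (dim_vec (g k))) \<Longrightarrow>
   hcat_list nr (map f xs) *\<^sub>v vconcat (map g xs) = foldr (\<lambda>k acc. f k *\<^sub>v g k + acc) xs (0\<^sub>v nr)"
proof (induction xs)
  case (Cons x xs)
  have "sum_list (map dim_col (map f xs)) = dim_vec (vconcat (map g xs))"
    unfolding dim_vconcat map_map
    by (rule arg_cong[where f = sum_list], rule map_cong) (use Cons.prems in auto)
  then have "hcat_list nr (map f xs) \<in> carrier_mat nr (dim_vec (vconcat (map g xs)))"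
    using hcat_list_carrier[of "map f xs" nr] Cons.prems by auto
  then show ?case
    using Cons by (simp add: hcat_list_def hcat_mult_append_vec[of _ nr "dim_vec (g x)"])
qed (auto simp: hcat_list_def intro!: eq_vecI)

section \<open>Constrained zonotopes\<close>

definition unit_box :: "nat \<Rightarrow> real vec set" where
  "unit_box n = {\<xi> \<in> carrier_vec n. \<forall>t < n. \<bar>\<xi> $ t\<bar> \<le> 1}"

lemma unit_box_carrier: "\<xi> \<in> unit_box n \<Longrightarrow> \<xi> \<in> carrier_vec n"
  unfolding unit_box_def by blast

lemma append_mem_unit_box_iff:
  assumes x: "x \<in> carrier_vec a" and y: "y \<in> carrier_vec b"
  shows "x @\<^sub>v y \<in> unit_box (a + b) \<longleftrightarrow> x \<in> unit_box a \<and> y \<in> unit_box b"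
proof -
  have "(\<forall>t < a + b. \<bar>(x @\<^sub>v y) $ t\<bar> \<le> 1) \<longleftrightarrow> (\<forall>t < a. \<bar>x $ t\<bar> \<le> 1) \<and> (\<forall>t < b. \<bar>y $ t\<bar> \<le> 1)"
  proof safe
    fix t assume box: "\<forall>t < a + b. \<bar>(x @\<^sub>v y) $ t\<bar> \<le> 1"
    show "t < a \<Longrightarrow> \<bar>x $ t\<bar> \<le> 1" using box[rule_format, of t] x y by simp
    show "t < b \<Longrightarrow> \<bar>y $ t\<bar> \<le> 1" using box[rule_format, of "a + t"] x y by simp
  next
    fix t assume "\<forall>t < a. \<bar>x $ t\<bar> \<le> 1" "\<forall>t < b. \<bar>y $ t\<bar> \<le> 1" "t < a + b"
    then show "\<bar>(x @\<^sub>v y) $ t\<bar> \<le> 1"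
      using x y by (cases "t < a") auto
  qed
  then show ?thesis using x y unfolding unit_box_def by auto
qed

lemma bex_unit_box_add_iff:
  "(\<exists>\<xi> \<in> unit_box (a + b). P \<xi>) \<longleftrightarrow> (\<exists>x \<in> unit_box a. \<exists>y \<in> unit_box b. P (x @\<^sub>v y))"
proof
  assume "\<exists>\<xi> \<in> unit_box (a + b). P \<xi>"
  then obtain \<xi> where \<xi>: "\<xi> \<in> unit_box (a + b)" "P \<xi>" by blast
  then have "\<xi> = vec_first \<xi> a @\<^sub>v vec_last \<xi> b"
    by (simp add: unit_box_carrier)
  with \<xi> show "\<exists>x \<in> unit_box a. \<exists>y \<in> unit_box b. P (x @\<^sub>v y)"
    by (metis append_mem_unit_box_iff vec_first_carrier vec_last_carrier)
qed (auto simp: append_mem_unit_box_iff unit_box_carrier)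

lemma mem_czono_iff:
  "G \<in> carrier_mat p g \<Longrightarrow> x \<in> czono G c A b \<longleftrightarrow> (\<exists>\<xi> \<in> unit_box g. A *\<^sub>v \<xi> = b \<and> x = c + G *\<^sub>v \<xi>)"
  unfolding czono_def unit_box_def by auto

lemma mem_zono_iff:
  "G \<in> carrier_mat p g \<Longrightarrow> x \<in> zono G c \<longleftrightarrow> (\<exists>\<xi> \<in> unit_box g. x = c + G *\<^sub>v \<xi>)"
  unfolding zono_def unit_box_def by auto

lemma czono_linear_image_sum:
  assumes F: "F \<in> carrier_mat p n" and G: "G \<in> carrier_mat n g" and c: "c \<in> carrier_vec n"
    and A: "A \<in> carrier_mat q g" and b: "b \<in> carrier_vec q" and d: "d \<in> carrier_vec p"
    and D: "D \<in> carrier_mat p m" and Gv: "Gv \<in> carrier_mat m gv" and cv: "cv \<in> carrier_vec m"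
    and Av: "Av \<in> carrier_mat qv gv"
  shows "{F *\<^sub>v z + d + D *\<^sub>v v | z v. z \<in> czono G c A b \<and> v \<in> czono Gv cv Av bv}
       = czono (hcat (F * G) (D * Gv)) (F *\<^sub>v c + d + D *\<^sub>v cv) (blkdiag A Av) (b @\<^sub>v bv)"
    (is "?L = czono ?G ?c ?A ?b")
proof -
  have point: "F *\<^sub>v (c + G *\<^sub>v x) + d + D *\<^sub>v (cv + Gv *\<^sub>v y) = ?c + ?G *\<^sub>v (x @\<^sub>v y)"
    if x: "x \<in> carrier_vec g" and y: "y \<in> carrier_vec gv" for x y
    using assms x y
    by (simp add: hcat_mult_append_vec[of _ p g _ gv] mult_add_distrib_mat_vec[of _ p n]
        mult_add_distrib_mat_vec[of _ p m]) (auto intro!: eq_vecI)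
  have cons: "?A *\<^sub>v (x @\<^sub>v y) = ?b \<longleftrightarrow> A *\<^sub>v x = b \<and> Av *\<^sub>v y = bv"
    if x: "x \<in> carrier_vec g" and y: "y \<in> carrier_vec gv" for x y
  proof -
    have "A *\<^sub>v x \<in> carrier_vec q" using A x by simp
    then show ?thesis using b by (simp add: blkdiag_mult_append_vec[OF A Av x y])
  qed
  have "?G \<in> carrier_mat p (g + gv)" using F G D Gv by (auto intro!: hcat_carrier)
  then have "w \<in> czono ?G ?c ?A ?b \<longleftrightarrow>
    (\<exists>x \<in> unit_box g. \<exists>y \<in> unit_box gv. A *\<^sub>v x = b \<and> Av *\<^sub>v y = bv \<and>
       w = F *\<^sub>v (c + G *\<^sub>v x) + d + D *\<^sub>v (cv + Gv *\<^sub>v y))" for w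
    by (simp add: mem_czono_iff bex_unit_box_add_iff point cons unit_box_carrier)
  moreover have "w \<in> ?L \<longleftrightarrow>
    (\<exists>x \<in> unit_box g. \<exists>y \<in> unit_box gv. A *\<^sub>v x = b \<and> Av *\<^sub>v y = bv \<and>
       w = F *\<^sub>v (c + G *\<^sub>v x) + d + D *\<^sub>v (cv + Gv *\<^sub>v y))" for w
    using G Gv by (auto simp: mem_czono_iff)
  ultimately show ?thesis by blast
qed

lemma czono_inter_nonempty_iff:
  assumes G1: "G1 \<in> carrier_mat p g1" and G2: "G2 \<in> carrier_mat p g2"
  shows "czono G1 c1 A1 b1 \<inter> czono G2 c2 A2 b2 \<noteq> {} \<longleftrightarrow>
    (\<exists>x1 \<in> unit_box g1. \<exists>x2 \<in> unit_box g2.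
      A1 *\<^sub>v x1 = b1 \<and> A2 *\<^sub>v x2 = b2 \<and> c1 + G1 *\<^sub>v x1 = c2 + G2 *\<^sub>v x2)"
    (is "?ne \<longleftrightarrow> ?ex")
proof
  assume ?ne
  then obtain w where "w \<in> czono G1 c1 A1 b1" "w \<in> czono G2 c2 A2 b2" by blast
  then show ?ex unfolding mem_czono_iff[OF G1] mem_czono_iff[OF G2] by blast
next
  assume ?ex
  then obtain x1 x2 where "x1 \<in> unit_box g1" "x2 \<in> unit_box g2" "A1 *\<^sub>v x1 = b1"
    "A2 *\<^sub>v x2 = b2" "c1 + G1 *\<^sub>v x1 = c2 + G2 *\<^sub>v x2"
    by blast
  then have "c1 + G1 *\<^sub>v x1 \<in> czono G1 c1 A1 b1 \<inter> czono G2 c2 A2 b2"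
    unfolding Int_iff mem_czono_iff[OF G1] mem_czono_iff[OF G2] by metis
  then show ?ne by blast
qed

lemma vec_eq_uminus_add_iff:
  fixes b e x :: "real vec"
  assumes "b \<in> carrier_vec n" "e \<in> carrier_vec n" "x \<in> carrier_vec n"
  shows "e = - b + x \<longleftrightarrow> x = b + e"
  using assms by (auto simp: vec_eq_iff)

lemma vec_diff_eq_add_diff_iff:
  fixes c1 c2 d1 d2 y1 y2 :: "real vec"
  assumes "c1 \<in> carrier_vec n" "c2 \<in> carrier_vec n" "d1 \<in> carrier_vec n" "d2 \<in> carrier_vec n"
    and "y1 \<in> carrier_vec n" "y2 \<in> carrier_vec n"
  shows "d2 - d1 = c1 - c2 + (y1 - y2) \<longleftrightarrow> c1 + d1 + y1 = c2 + d2 + y2"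
proof -
  have "d2 - d1 = c1 - c2 + (y1 - y2) \<longleftrightarrow>
      (\<forall>i < n. d2 $ i - d1 $ i = c1 $ i - c2 $ i + (y1 $ i - y2 $ i))"
    using assms by (simp add: vec_eq_iff)
  also have "\<dots> \<longleftrightarrow> (\<forall>i < n. c1 $ i + d1 $ i + y1 $ i = c2 $ i + d2 $ i + y2 $ i)"
    by (intro all_cong) linarith
  also have "\<dots> \<longleftrightarrow> c1 + d1 + y1 = c2 + d2 + y2"
    using assms by (simp add: vec_eq_iff add.assoc)
  finally show ?thesis .
qed

lemma czono_disjoint_iff_not_mem_zono:
  assumes G1: "G1 \<in> carrier_mat p g1" and G2: "G2 \<in> carrier_mat p g2"
    and A1: "A1 \<in> carrier_mat q1 g1" and A2: "A2 \<in> carrier_mat q2 g2"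
    and c: "c1 \<in> carrier_vec p" "c2 \<in> carrier_vec p" "d1 \<in> carrier_vec p" "d2 \<in> carrier_vec p"
    and b: "b1 \<in> carrier_vec q1" "e1 \<in> carrier_vec q1" "b2 \<in> carrier_vec q2" "e2 \<in> carrier_vec q2"
  shows "czono G1 (c1 + d1) A1 (b1 + e1) \<inter> czono G2 (c2 + d2) A2 (b2 + e2) = {} \<longleftrightarrow>
    (d2 - d1) @\<^sub>v e1 @\<^sub>v e2 \<notin> zono (hcat G1 (- G2) @\<^sub>r blkdiag A1 A2) ((c1 - c2) @\<^sub>v - (b1 @\<^sub>v b2))"
    (is "_ \<longleftrightarrow> ?w \<notin> zono ?M ?c")
proof -
  have point: "?w = ?c + ?M *\<^sub>v (x1 @\<^sub>v x2) \<longleftrightarrow>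
      A1 *\<^sub>v x1 = b1 + e1 \<and> A2 *\<^sub>v x2 = b2 + e2 \<and> c1 + d1 + G1 *\<^sub>v x1 = c2 + d2 + G2 *\<^sub>v x2"
    if x1: "x1 \<in> carrier_vec g1" and x2: "x2 \<in> carrier_vec g2" for x1 x2
  proof -
    have "?c + ?M *\<^sub>v (x1 @\<^sub>v x2) =
        ((c1 - c2) + (G1 *\<^sub>v x1 - G2 *\<^sub>v x2)) @\<^sub>v (- b1 + A1 *\<^sub>v x1) @\<^sub>v (- b2 + A2 *\<^sub>v x2)"
      using assms x1 x2
      by (simp add: mat_mult_append[of _ p "g1 + g2" _ "q1 + q2"] hcat_carrier blkdiag_carrier
          hcat_mult_append_vec[of _ p g1 _ g2] blkdiag_mult_append_vec[OF A1 A2 x1 x2]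
          uminus_append_vec append_vec_add[of _ p _ _ "q1 + q2"] append_vec_add[of _ q1 _ _ q2]
          minus_add_uminus_vec[of _ p])
    moreover have "G1 *\<^sub>v x1 \<in> carrier_vec p" "G2 *\<^sub>v x2 \<in> carrier_vec p"
      "A1 *\<^sub>v x1 \<in> carrier_vec q1" "A2 *\<^sub>v x2 \<in> carrier_vec q2"
      using assms x1 x2 by simp_all
    ultimately show ?thesis
      using c b by (simp add: append_vec_eq[of _ p] append_vec_eq[of _ q1]
          vec_eq_uminus_add_iff vec_diff_eq_add_diff_iff conj_commute)
  qed
  have "?M \<in> carrier_mat (p + (q1 + q2)) (g1 + g2)"
    using assms by (auto intro!: hcat_carrier blkdiag_carrier)
  then have "?w \<in> zono ?M ?c \<longleftrightarrow> (\<exists>x1 \<in> unit_box g1. \<exists>x2 \<in> unit_box g2.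
      A1 *\<^sub>v x1 = b1 + e1 \<and> A2 *\<^sub>v x2 = b2 + e2 \<and> c1 + d1 + G1 *\<^sub>v x1 = c2 + d2 + G2 *\<^sub>v x2)"
    by (simp add: mem_zono_iff bex_unit_box_add_iff point unit_box_carrier)
  then show ?thesis
    using czono_inter_nonempty_iff[OF G1 G2, of "c1 + d1" A1 "b1 + e1" "c2 + d2" A2 "b2 + e2"]
    by blast
qed

section \<open>The state reachable set\<close>

lemma useq_carrier [simp]: "useq nu ubar k \<in> carrier_vec nu"
  unfolding useq_def by simp

lemma dim_useq [simp]: "dim_vec (useq nu ubar k) = nu"
  unfolding useq_def by simp

lemma vconcat_useq:
  "k * nu \<le> dim_vec v \<Longrightarrow> vconcat (map (useq nu v) [0..<k]) = vec (k * nu) (\<lambda>i. v $ i)"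
proof (induction k)
  case (Suc k)
  then have IH: "vconcat (map (useq nu v) [0..<k]) = vec (k * nu) (\<lambda>i. v $ i)" by simp
  show ?case unfolding upt_Suc_append[OF le0] map_append vconcat_append IH
    by (rule eq_vecI) (auto simp: vconcat_single useq_def algebra_simps)
qed (auto intro!: eq_vecI)

lemma vconcat_map_useq:
  "ubar \<in> carrier_vec ((N + 1) * nu) \<Longrightarrow> vconcat (map (useq nu ubar) [0..<N + 1]) = ubar"
  by (subst vconcat_useq) (auto intro!: eq_vecI)

lemma append_useq_last:
  assumes "ubar \<in> carrier_vec ((N + 1) * nu)"
  shows "vec_first ubar (N * nu) @\<^sub>v useq nu ubar N = ubar"
proof -
  have "useq nu ubar N = vec_last ubar nu"
    using assms unfolding useq_def vec_last_def by (intro eq_vecI) (auto simp: algebra_simps)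
  moreover have "ubar \<in> carrier_vec (N * nu + nu)" using assms by (simp add: algebra_simps)
  ultimately show ?thesis by simp
qed

lemma useq_zero_seq: "k \<le> N \<Longrightarrow> useq nu (zero_seq N nu) k = 0\<^sub>v nu"
proof (rule eq_vecI)
  fix i assume k: "k \<le> N" and i: "i < dim_vec (0\<^sub>v nu)"
  have "k * nu + i < (N + 1) * nu"
  proof -
    have "k * nu + i < k * nu + nu" using i by simp
    also have "\<dots> \<le> (N + 1) * nu" using k by (simp add: mult_le_mono1 algebra_simps)
    finally show ?thesis .
  qed
  then show "useq nu (zero_seq N nu) k $ i = 0\<^sub>v nu $ i"
    using i unfolding useq_def zero_seq_def by simp
qed (simp add: useq_def)

lemma czrec_cong: "(\<And>j. j \<le> k \<Longrightarrow> u j = u' j) \<Longrightarrow> czrec m u k = czrec m u' k"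
proof (induction k)
  case (Suc k)
  then have "czrec m u k = czrec m u' k" "u k = u' k" "u (Suc k) = u' (Suc k)" by simp_all
  then show ?case by simp
qed simp

text \<open>Beyond index \<open>N\<close>, \<open>useq\<close> reads outside \<open>zero_seq N nu\<close> and yields unspecified entries;
  these never reach \<open>czrec\<close> at step \<open>N\<close>.\<close>

lemma czrec_zero_seq: "czrec m (useq nu (zero_seq N nu)) N = czrec m (\<lambda>_. 0\<^sub>v nu) N"
  by (rule czrec_cong) (simp add: useq_zero_seq)

locale dmodel_dims =
  fixes m :: dmodel and ny nu nv n nw r gz qz ga qa :: nat
  assumes At: "At m \<in> carrier_mat n (n + nw)" and Ac: "Ac m \<in> carrier_mat r (n + nw)"
    and Bt: "Bt m \<in> carrier_mat n nu" and Bc: "Bc m \<in> carrier_mat r nu"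
    and Fm: "Fm m \<in> carrier_mat ny (n + nw)" and Dm: "Dm m \<in> carrier_mat ny nu"
    and Dvm: "Dvm m \<in> carrier_mat ny nv"
    and Gz: "Gz m \<in> carrier_mat (n + nw) gz" and cz: "cz m \<in> carrier_vec (n + nw)"
    and Az: "Az m \<in> carrier_mat qz gz" and bz: "bz m \<in> carrier_vec qz"
    and Ga: "Ga m \<in> carrier_mat (n + nw) ga" and ca: "ca m \<in> carrier_vec (n + nw)"
    and Aa: "Aa m \<in> carrier_mat qa ga" and ba: "ba m \<in> carrier_vec qa"

lemma wf_model_dmodel_dims:
  assumes "wf_model ny nu nv m"
  obtains n nw r gz qz ga qa where "dmodel_dims m ny nu nv n nw r gz qz ga qa"
  using assms unfolding wf_model_def by (elim exE) (rule that, unfold dmodel_dims_def, blast)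

context dmodel_dims
begin

lemma Gac_carrier: "Gac m \<in> carrier_mat nw ga"
  using At Ga unfolding Gac_def by auto

lemma cac_carrier: "cac m \<in> carrier_vec nw"
  using At ca unfolding cac_def by auto

lemma Mmat_carrier: "Mmat m \<in> carrier_mat (n + nw) (n + nw)"
  using At unfolding Mmat_def by auto

lemma Bt0_carrier: "Bt0 m \<in> carrier_mat (n + nw) nu"
  using At Bt unfolding Bt0_def by auto

lemma Mmat_mult_vec:
  assumes x: "x \<in> carrier_vec (n + nw)"
  shows "Mmat m *\<^sub>v x = (At m *\<^sub>v x) @\<^sub>v 0\<^sub>v nw"
proof -
  have "Mmat m = At m @\<^sub>r 0\<^sub>m nw (n + nw)" unfolding Mmat_def using At by simp
  then show ?thesis using mat_mult_append[OF At _ x, of "0\<^sub>m nw (n + nw)" nw] x by simp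
qed

lemma Bt0_mult_vec:
  assumes y: "y \<in> carrier_vec nu"
  shows "Bt0 m *\<^sub>v y = (Bt m *\<^sub>v y) @\<^sub>v 0\<^sub>v nw"
proof -
  have "Bt0 m = Bt m @\<^sub>r 0\<^sub>m nw nu" unfolding Bt0_def using At Bt by simp
  then show ?thesis using mat_mult_append[OF Bt _ y, of "0\<^sub>m nw nu" nw] y by simp
qed

definition "Grec u k = fst (czrec m u k)"
definition "crec u k = fst (snd (czrec m u k))"
definition "Arec u k = fst (snd (snd (czrec m u k)))"
definition "brec u k = snd (snd (snd (czrec m u k)))"

lemma rec_0:
  "Grec u 0 = Gz m" "crec u 0 = cz m" "Arec u 0 = Az m @\<^sub>r (Ac m * Gz m)"
  "brec u 0 = bz m @\<^sub>v (- (Ac m *\<^sub>v cz m) - Bc m *\<^sub>v u 0)"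
  unfolding Grec_def crec_def Arec_def brec_def by auto

lemma rec_Suc:
  "Grec u (Suc k) = blkdiag (At m * Grec u k) (Gac m)"
  "crec u (Suc k) = (At m *\<^sub>v crec u k + Bt m *\<^sub>v u k) @\<^sub>v cac m"
  "Arec u (Suc k) = blkdiag (Arec u k) (Aa m) @\<^sub>r (Ac m * blkdiag (At m * Grec u k) (Gac m))"
  "brec u (Suc k) = brec u k @\<^sub>v ba m @\<^sub>v (- (Ac m *\<^sub>v crec u (Suc k)) - Bc m *\<^sub>v u (Suc k))"
  by (cases "czrec m u k"; simp add: Grec_def crec_def Arec_def brec_def Let_def)+

abbreviation "ngen k \<equiv> gz + k * ga"
abbreviation "ncon k \<equiv> qz + r + k * (qa + r)"

lemma rec_carrier:
  assumes u: "\<And>j. u j \<in> carrier_vec nu"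
  shows "Grec u k \<in> carrier_mat (n + nw) (ngen k) \<and> crec u k \<in> carrier_vec (n + nw) \<and>
    Arec u k \<in> carrier_mat (ncon k) (ngen k) \<and> brec u k \<in> carrier_vec (ncon k)"
proof (induction k)
  case 0
  show ?case unfolding rec_0 using At Ac Bc Gz cz Az bz u[of 0] by auto
next
  case (Suc k)
  then have G: "Grec u k \<in> carrier_mat (n + nw) (ngen k)" and c: "crec u k \<in> carrier_vec (n + nw)"
    and A: "Arec u k \<in> carrier_mat (ncon k) (ngen k)" and b: "brec u k \<in> carrier_vec (ncon k)"
    by auto
  have GS: "blkdiag (At m * Grec u k) (Gac m) \<in> carrier_mat (n + nw) (ngen k + ga)"
    using blkdiag_carrier[OF mult_carrier_mat[OF At G] Gac_carrier] by simp
  then have G': "Grec u (Suc k) \<in> carrier_mat (n + nw) (ngen (Suc k))"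
    by (simp add: rec_Suc add_ac)
  have c': "crec u (Suc k) \<in> carrier_vec (n + nw)"
    using At Bt c u[of k] cac_carrier by (auto simp: rec_Suc)
  have "Arec u (Suc k) \<in> carrier_mat (ncon k + qa + r) (ngen k + ga)"
    using carrier_append_rows[OF blkdiag_carrier[OF A Aa] mult_carrier_mat[OF Ac GS]]
    by (simp add: rec_Suc)
  moreover have "brec u (Suc k) \<in> carrier_vec (ncon k + qa + r)"
  proof (rule carrier_vecI)
    show "dim_vec (brec u (Suc k)) = ncon k + qa + r"
      using b ba Bc unfolding rec_Suc(4) by simp
  qed
  ultimately show ?case using G' c' by (simp add: algebra_simps)
qed

lemma
  assumes "\<And>j. u j \<in> carrier_vec nu"
  shows Grec_carrier: "Grec u k \<in> carrier_mat (n + nw) (ngen k)"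
    and crec_carrier: "crec u k \<in> carrier_vec (n + nw)"
    and Arec_carrier: "Arec u k \<in> carrier_mat (ncon k) (ngen k)"
    and brec_carrier: "brec u k \<in> carrier_vec (ncon k)"
  using rec_carrier[OF assms] by auto

lemma Grec_Arec_input_indep: "Grec u k = Grec u' k \<and> Arec u k = Arec u' k"
  by (induction k) (simp_all add: rec_0 rec_Suc)

text \<open>The input-driven part \<open>c\<^sub>k(u) - c\<^sub>k(0)\<close> of the centre; \<open>H\<^sub>k\<close> computes it from \<open>u\<close>.\<close>

primrec forced_centre :: "(nat \<Rightarrow> real vec) \<Rightarrow> nat \<Rightarrow> real vec" where
  "forced_centre u 0 = 0\<^sub>v (n + nw)"
| "forced_centre u (Suc k) = Mmat m *\<^sub>v forced_centre u k + Bt0 m *\<^sub>v u k"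

lemma forced_centre_carrier:
  "(\<And>j. u j \<in> carrier_vec nu) \<Longrightarrow> forced_centre u k \<in> carrier_vec (n + nw)"
  by (induction k) (use Mmat_carrier Bt0_carrier in auto)

lemma crec_eq_free_plus_forced:
  assumes u: "\<And>j. u j \<in> carrier_vec nu"
  shows "crec u k = crec (\<lambda>_. 0\<^sub>v nu) k + forced_centre u k"
proof (induction k)
  case 0
  show ?case using cz by (simp add: rec_0)
next
  case (Suc k)
  have c0: "crec (\<lambda>_. 0\<^sub>v nu) k \<in> carrier_vec (n + nw)" by (rule crec_carrier) simp
  have d: "forced_centre u k \<in> carrier_vec (n + nw)" using forced_centre_carrier[OF u] .
  have uk: "u k \<in> carrier_vec nu" using u .
  have "crec u (Suc k) = (At m *\<^sub>v crec (\<lambda>_. 0\<^sub>v nu) k + At m *\<^sub>v forced_centre u k + Bt m *\<^sub>v u k) @\<^sub>v cac m"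
    using Suc mult_add_distrib_mat_vec[OF At c0 d] by (simp add: rec_Suc)
  moreover have "crec (\<lambda>_. 0\<^sub>v nu) (Suc k) = (At m *\<^sub>v crec (\<lambda>_. 0\<^sub>v nu) k) @\<^sub>v cac m"
    using Bt c0 At by (simp add: rec_Suc)
  moreover have "forced_centre u (Suc k) = (At m *\<^sub>v forced_centre u k + Bt m *\<^sub>v u k) @\<^sub>v 0\<^sub>v nw"
    using At Bt d uk
    by (simp add: Mmat_mult_vec Bt0_mult_vec append_vec_add[of _ n _ _ nw])
  ultimately show ?case
    by (intro eq_vecI) (use At Bt d uk c0 cac_carrier in \<open>auto simp: nth_append\<close>)
qed

definition Hblock :: "nat \<Rightarrow> nat \<Rightarrow> real mat" where
  "Hblock h k = (if k < h then Mmat m ^\<^sub>m (h - Suc k) * Bt0 m else 0\<^sub>m (n + nw) nu)"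

lemma Hblock_carrier: "Hblock h k \<in> carrier_mat (n + nw) nu"
  unfolding Hblock_def using Mmat_carrier Bt0_carrier by auto

lemma dim_col_Hblock [simp]: "dim_col (Hblock h k) = nu"
  by (rule carrier_matD(2)[OF Hblock_carrier])

lemma Hmat_eq_hcat_list: "Hmat m N nu h = hcat_list (n + nw) (map (Hblock h) [0..<N + 1])"
proof -
  have dim: "dim_col (At m) = n + nw" using At by simp
  show ?thesis unfolding Hmat_def Hblock_def dim ..
qed

lemma Hmat_carrier: "Hmat m N nu h \<in> carrier_mat (n + nw) ((N + 1) * nu)"
proof -
  have "hcat_list (n + nw) (map (Hblock h) [0..<N + 1])
      \<in> carrier_mat (n + nw) (sum_list (map dim_col (map (Hblock h) [0..<N + 1])))"
    by (rule hcat_list_carrier) (auto simp: carrier_matD[OF Hblock_carrier])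
  moreover have "sum_list (map dim_col (map (Hblock h) [0..<N + 1])) = (N + 1) * nu"
    by (simp add: o_def sum_list_triv del: upt_Suc)
  ultimately show ?thesis unfolding Hmat_eq_hcat_list by (simp add: add.commute)
qed

lemma Hblock_Suc_mult_vec:
  assumes y: "y \<in> carrier_vec nu"
  shows "Hblock (Suc h) k *\<^sub>v y =
    Mmat m *\<^sub>v (Hblock h k *\<^sub>v y) + (if k = h then Bt0 m *\<^sub>v y else 0\<^sub>v (n + nw))"
proof (cases "k < h")
  case True
  have P: "Mmat m ^\<^sub>m (h - Suc k) \<in> carrier_mat (n + nw) (n + nw)"
    using Mmat_carrier by simp
  have "h - k = Suc (h - Suc k)" using True by arith
  then have "Hblock (Suc h) k = Mmat m * Hblock h k"
    using True pow_mat_Suc_left[OF Mmat_carrier]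
    by (simp add: Hblock_def assoc_mult_mat[OF Mmat_carrier P Bt0_carrier])
  then have "Hblock (Suc h) k *\<^sub>v y = Mmat m *\<^sub>v (Hblock h k *\<^sub>v y)"
    using assoc_mult_mat_vec[OF Mmat_carrier Hblock_carrier y] by simp
  moreover have "Mmat m *\<^sub>v (Hblock h k *\<^sub>v y) \<in> carrier_vec (n + nw)"
    using mult_mat_vec_carrier[OF Mmat_carrier mult_mat_vec_carrier[OF Hblock_carrier y]] .
  ultimately show ?thesis using True by simp
next
  case False
  then show ?thesis unfolding Hblock_def using Mmat_carrier Bt0_carrier y by simp
qed

definition Hblock_sum :: "(nat \<Rightarrow> real vec) \<Rightarrow> nat \<Rightarrow> nat list \<Rightarrow> real vec" where
  "Hblock_sum u h ks = foldr (\<lambda>k acc. Hblock h k *\<^sub>v u k + acc) ks (0\<^sub>v (n + nw))"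

lemma Hblock_sum_carrier:
  "(\<And>j. u j \<in> carrier_vec nu) \<Longrightarrow> Hblock_sum u h ks \<in> carrier_vec (n + nw)"
  unfolding Hblock_sum_def
  by (induction ks) (auto intro!: add_carrier_vec mult_mat_vec_carrier[OF Hblock_carrier])

lemma Hblock_sum_0: "(\<And>j. u j \<in> carrier_vec nu) \<Longrightarrow> Hblock_sum u 0 ks = 0\<^sub>v (n + nw)"
  unfolding Hblock_sum_def by (induction ks) (auto simp: Hblock_def)

lemma Hblock_sum_Suc:
  assumes u: "\<And>j. u j \<in> carrier_vec nu" and "distinct ks"
  shows "Hblock_sum u (Suc h) ks =
    Mmat m *\<^sub>v Hblock_sum u h ks + (if h \<in> set ks then Bt0 m *\<^sub>v u h else 0\<^sub>v (n + nw))"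
  using \<open>distinct ks\<close>
proof (induction ks)
  case Nil
  then show ?case unfolding Hblock_sum_def using Mmat_carrier by simp
next
  case (Cons k ks)
  have S: "Hblock_sum u h ks \<in> carrier_vec (n + nw)" using Hblock_sum_carrier[OF u] .
  have B: "Hblock h k *\<^sub>v u k \<in> carrier_vec (n + nw)"
    using mult_mat_vec_carrier[OF Hblock_carrier u] .
  have "Hblock_sum u (Suc h) (k # ks) = Hblock (Suc h) k *\<^sub>v u k + Hblock_sum u (Suc h) ks"
    "Hblock_sum u h (k # ks) = Hblock h k *\<^sub>v u k + Hblock_sum u h ks"
    unfolding Hblock_sum_def by simp_all
  then show ?case
    using Cons Hblock_Suc_mult_vec[OF u[of k]] mult_add_distrib_mat_vec[OF Mmat_carrier B S]
    by (intro eq_vecI) (use Mmat_carrier Bt0_carrier u[of h] B S in auto)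
qed

lemma Hmat_mult_vec:
  assumes ub: "ubar \<in> carrier_vec ((N + 1) * nu)" and h: "h \<le> N"
  shows "Hmat m N nu h *\<^sub>v ubar = forced_centre (useq nu ubar) h"
proof -
  have "Hmat m N nu h *\<^sub>v ubar =
      hcat_list (n + nw) (map (Hblock h) [0..<N + 1]) *\<^sub>v vconcat (map (useq nu ubar) [0..<N + 1])"
    unfolding Hmat_eq_hcat_list vconcat_map_useq[OF ub] ..
  also have "\<dots> = Hblock_sum (useq nu ubar) h [0..<N + 1]"
    unfolding Hblock_sum_def by (rule mult_hcat_list_vconcat) (simp add: Hblock_carrier)
  also have "\<dots> = forced_centre (useq nu ubar) h"
    using h
  proof (induction h)
    case 0
    show ?case by (simp add: Hblock_sum_0)
  next
    case (Suc h)
    then show ?case by (simp add: Hblock_sum_Suc del: upt_Suc)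
  qed
  finally show ?thesis .
qed

definition ncon_block :: "nat \<Rightarrow> nat" where
  "ncon_block j = (if j = 0 then qz else qa)"

lemma sum_list_ncon_block: "sum_list (map (\<lambda>j. ncon_block j + r) [0..<Suc N]) = ncon N"
  by (induction N) (auto simp: ncon_block_def)

definition brec_block :: "(nat \<Rightarrow> real vec) \<Rightarrow> nat \<Rightarrow> real vec" where
  "brec_block u j = (if j = 0 then bz m else ba m) @\<^sub>v (- (Ac m *\<^sub>v crec u j) - Bc m *\<^sub>v u j)"

lemma brec_eq_vconcat: "brec u k = vconcat (map (brec_block u) [0..<Suc k])"
proof (induction k)
  case (Suc k)
  have "brec u (Suc k) = brec u k @\<^sub>v brec_block u (Suc k)"
    unfolding rec_Suc(4) brec_block_def by simp
  also have "\<dots> = vconcat (map (brec_block u) [0..<Suc k] @ [brec_block u (Suc k)])"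
    unfolding Suc vconcat_append vconcat_single ..
  finally show ?case by simp
qed (simp add: rec_0 brec_block_def append_vec_empty)

definition Gamma_block :: "nat \<Rightarrow> real mat" where
  "Gamma_block j = 0\<^sub>m (if j = 0 then dim_vec (bz m) else dim_vec (ba m)) (dim_col (Bc m)) @\<^sub>r (- Bc m)"

definition Upsilon_block :: "nat \<Rightarrow> real mat" where
  "Upsilon_block j = 0\<^sub>m (if j = 0 then dim_vec (bz m) else dim_vec (ba m)) (dim_col (Ac m)) @\<^sub>r (- Ac m)"

lemma Gamma_eq_diag_block_mat: "Gamma m N = diag_block_mat (map Gamma_block [0..<N + 1])"
  unfolding Gamma_def Gamma_block_def ..

lemma Upsilon_eq_diag_block_mat: "Upsilon m N = diag_block_mat (map Upsilon_block [0..<N + 1])"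
  unfolding Upsilon_def Upsilon_block_def ..

lemma Gamma_block_eq: "Gamma_block j = 0\<^sub>m (ncon_block j) nu @\<^sub>r (- Bc m)"
  unfolding Gamma_block_def ncon_block_def using bz ba Bc by auto

lemma Upsilon_block_eq: "Upsilon_block j = 0\<^sub>m (ncon_block j) (n + nw) @\<^sub>r (- Ac m)"
  unfolding Upsilon_block_def ncon_block_def using bz ba Ac by auto

lemma Gamma_block_carrier: "Gamma_block j \<in> carrier_mat (ncon_block j + r) nu"
  unfolding Gamma_block_eq using Bc by auto

lemma Upsilon_block_carrier: "Upsilon_block j \<in> carrier_mat (ncon_block j + r) (n + nw)"
  unfolding Upsilon_block_eq using Ac by auto

lemma dim_Gamma_block [simp]:
  "dim_row (Gamma_block j) = ncon_block j + r" "dim_col (Gamma_block j) = nu"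
  using carrier_matD[OF Gamma_block_carrier] by simp_all

lemma dim_Upsilon_block [simp]:
  "dim_row (Upsilon_block j) = ncon_block j + r" "dim_col (Upsilon_block j) = n + nw"
  using carrier_matD[OF Upsilon_block_carrier] by simp_all

lemma Gamma_block_mult_vec:
  "y \<in> carrier_vec nu \<Longrightarrow> Gamma_block j *\<^sub>v y = 0\<^sub>v (ncon_block j) @\<^sub>v (- (Bc m *\<^sub>v y))"
  unfolding Gamma_block_eq using Bc by (simp add: mat_mult_append[of _ "ncon_block j" nu _ r])

lemma Upsilon_block_mult_vec:
  "x \<in> carrier_vec (n + nw) \<Longrightarrow> Upsilon_block j *\<^sub>v x = 0\<^sub>v (ncon_block j) @\<^sub>v (- (Ac m *\<^sub>v x))"
  unfolding Upsilon_block_eq using Ac by (simp add: mat_mult_append[of _ "ncon_block j" "n + nw" _ r])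

lemma Gamma_carrier: "Gamma m N \<in> carrier_mat (ncon N) ((N + 1) * nu)"
  unfolding Gamma_eq_diag_block_mat
  by (intro carrier_matI)
     (simp_all add: dim_diag_block_mat o_def sum_list_ncon_block sum_list_triv del: upt_Suc)

lemma Upsilon_carrier: "Upsilon m N \<in> carrier_mat (ncon N) ((N + 1) * (n + nw))"
  unfolding Upsilon_eq_diag_block_mat
  by (intro carrier_matI)
     (simp_all add: dim_diag_block_mat o_def sum_list_ncon_block sum_list_triv del: upt_Suc)

lemma Hbar_carrier: "Hbar m N nu \<in> carrier_mat ((N + 1) * (n + nw)) ((N + 1) * nu)"
proof -
  have "vcat_list ((N + 1) * nu) (map (Hmat m N nu) [0..<N + 1])
      \<in> carrier_mat (sum_list (map dim_row (map (Hmat m N nu) [0..<N + 1]))) ((N + 1) * nu)"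
    by (rule vcat_list_carrier) (auto simp: carrier_matD[OF Hmat_carrier])
  moreover have "sum_list (map dim_row (map (Hmat m N nu) [0..<N + 1])) = (N + 1) * (n + nw)"
    by (simp add: o_def sum_list_triv carrier_matD[OF Hmat_carrier] del: upt_Suc)
  ultimately show ?thesis unfolding Hbar_def by simp
qed

lemma OmegaN_carrier: "OmegaN m N nu \<in> carrier_mat (ncon N) ((N + 1) * nu)"
  unfolding OmegaN_def
  using add_carrier_mat[OF mult_carrier_mat[OF Upsilon_carrier Hbar_carrier]] .

definition Omega_block :: "(nat \<Rightarrow> real vec) \<Rightarrow> nat \<Rightarrow> real vec" where
  "Omega_block u j = 0\<^sub>v (ncon_block j) @\<^sub>v (- (Ac m *\<^sub>v forced_centre u j) - Bc m *\<^sub>v u j)"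

lemma OmegaN_mult_vec:
  assumes ub: "ubar \<in> carrier_vec ((N + 1) * nu)"
  shows "OmegaN m N nu *\<^sub>v ubar = vconcat (map (Omega_block (useq nu ubar)) [0..<N + 1])"
proof -
  let ?u = "useq nu ubar" and ?js = "[0..<N + 1]"
  have "OmegaN m N nu *\<^sub>v ubar = Gamma m N *\<^sub>v ubar + Upsilon m N *\<^sub>v (Hbar m N nu *\<^sub>v ubar)"
    unfolding OmegaN_def
      add_mult_distrib_mat_vec[OF Gamma_carrier mult_carrier_mat[OF Upsilon_carrier Hbar_carrier] ub]
      assoc_mult_mat_vec[OF Upsilon_carrier Hbar_carrier ub] ..
  also have "Hbar m N nu *\<^sub>v ubar = vconcat (map (forced_centre ?u) ?js)"
  proof -
    have "Hbar m N nu *\<^sub>v ubar = vconcat (map (\<lambda>M. M *\<^sub>v ubar) (map (Hmat m N nu) ?js))"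
      unfolding Hbar_def by (rule mult_vcat_list) (use ub carrier_matD[OF Hmat_carrier] in auto)
    also have "map (\<lambda>M. M *\<^sub>v ubar) (map (Hmat m N nu) ?js) = map (forced_centre ?u) ?js"
      using Hmat_mult_vec[OF ub] by (auto simp del: upt_Suc)
    finally show ?thesis .
  qed
  also have "Upsilon m N *\<^sub>v vconcat (map (forced_centre ?u) ?js) =
      vconcat (map (\<lambda>j. Upsilon_block j *\<^sub>v forced_centre ?u j) ?js)"
    unfolding Upsilon_eq_diag_block_mat
    by (subst mult_diag_block_mat_vconcat)
       (simp_all add: map2_map_map carrier_matD[OF Upsilon_block_carrier]
         forced_centre_carrier[THEN carrier_vecD] del: upt_Suc)
  also have "Gamma m N *\<^sub>v ubar = vconcat (map (\<lambda>j. Gamma_block j *\<^sub>v ?u j) ?js)"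
    unfolding Gamma_eq_diag_block_mat
    by (subst vconcat_map_useq[OF ub, symmetric], subst mult_diag_block_mat_vconcat)
       (simp_all add: map2_map_map carrier_matD[OF Gamma_block_carrier] del: upt_Suc)
  also have "vconcat (map (\<lambda>j. Gamma_block j *\<^sub>v ?u j) ?js) +
      vconcat (map (\<lambda>j. Upsilon_block j *\<^sub>v forced_centre ?u j) ?js) =
      vconcat (map (\<lambda>j. Gamma_block j *\<^sub>v ?u j + Upsilon_block j *\<^sub>v forced_centre ?u j) ?js)"
    by (rule vconcat_add) simp
  also have "map (\<lambda>j. Gamma_block j *\<^sub>v ?u j + Upsilon_block j *\<^sub>v forced_centre ?u j) ?js =
      map (Omega_block ?u) ?js"
  proof (rule map_cong[OF refl])
    fix j
    have d: "forced_centre ?u j \<in> carrier_vec (n + nw)" by (rule forced_centre_carrier) simp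
    show "Gamma_block j *\<^sub>v ?u j + Upsilon_block j *\<^sub>v forced_centre ?u j = Omega_block ?u j"
      unfolding Gamma_block_mult_vec[OF useq_carrier] Upsilon_block_mult_vec[OF d] Omega_block_def
      by (rule eq_vecI) (use Ac Bc d in auto)
  qed
  finally show ?thesis .
qed

lemma rec_N_eq:
  "GN m N nu ubar = Grec (useq nu ubar) N" "cN m N nu ubar = crec (useq nu ubar) N"
  "AN m N nu ubar = Arec (useq nu ubar) N" "bN m N nu ubar = brec (useq nu ubar) N"
  unfolding GN_def Grec_def cN_def crec_def AN_def Arec_def bN_def brec_def by simp_all

lemma
  shows GN_carrier: "GN m N nu ubar \<in> carrier_mat (n + nw) (ngen N)"
    and cN_carrier: "cN m N nu ubar \<in> carrier_vec (n + nw)"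
    and AN_carrier: "AN m N nu ubar \<in> carrier_mat (ncon N) (ngen N)"
    and bN_carrier: "bN m N nu ubar \<in> carrier_vec (ncon N)"
  unfolding rec_N_eq by (rule Grec_carrier crec_carrier Arec_carrier brec_carrier; simp)+

lemma GN_AN_input_indep: "GN m N nu ubar = GN m N nu ubar'" "AN m N nu ubar = AN m N nu ubar'"
  unfolding rec_N_eq using Grec_Arec_input_indep by auto

lemma rec_zero_seq:
  "crec (useq nu (zero_seq N nu)) N = crec (\<lambda>_. 0\<^sub>v nu) N"
  "brec (useq nu (zero_seq N nu)) N = brec (\<lambda>_. 0\<^sub>v nu) N"
  unfolding crec_def brec_def czrec_zero_seq by simp_all

lemma cN_affine:
  assumes ub: "ubar \<in> carrier_vec ((N + 1) * nu)"
  shows "cN m N nu ubar = cN m N nu (zero_seq N nu) + Hmat m N nu N *\<^sub>v ubar"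
  unfolding rec_N_eq rec_zero_seq Hmat_mult_vec[OF ub le_refl]
  by (rule crec_eq_free_plus_forced) simp

lemma bN_affine:
  assumes ub: "ubar \<in> carrier_vec ((N + 1) * nu)"
  shows "bN m N nu ubar = bN m N nu (zero_seq N nu) + OmegaN m N nu *\<^sub>v ubar"
proof -
  let ?u = "useq nu ubar" and ?z = "\<lambda>_. 0\<^sub>v nu" and ?js = "[0..<Suc N]"
  have "bN m N nu (zero_seq N nu) + OmegaN m N nu *\<^sub>v ubar =
      vconcat (map (brec_block ?z) ?js) + vconcat (map (Omega_block ?u) ?js)"
    unfolding rec_N_eq rec_zero_seq unfolding brec_eq_vconcat OmegaN_mult_vec[OF ub] by simp
  also have "\<dots> = vconcat (map (\<lambda>j. brec_block ?z j + Omega_block ?u j) ?js)"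
  proof (rule vconcat_add)
    fix j
    have "crec ?z j \<in> carrier_vec (n + nw)" by (rule crec_carrier) simp
    then show "dim_vec (brec_block ?z j) = dim_vec (Omega_block ?u j)"
      unfolding brec_block_def Omega_block_def ncon_block_def using bz ba Ac Bc by simp
  qed
  also have "map (\<lambda>j. brec_block ?z j + Omega_block ?u j) ?js = map (brec_block ?u) ?js"
  proof (rule map_cong[OF refl])
    fix j
    have c0: "crec ?z j \<in> carrier_vec (n + nw)" by (rule crec_carrier) simp
    have d: "forced_centre ?u j \<in> carrier_vec (n + nw)" by (rule forced_centre_carrier) simp
    have row: "\<And>i. row (Ac m) i \<in> carrier_vec (n + nw)" using Ac by (intro carrier_vecI) simp
    show "brec_block ?z j + Omega_block ?u j = brec_block ?u j"
      unfolding brec_block_def Omega_block_def crec_eq_free_plus_forced[of ?u, OF useq_carrier]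
        mult_add_distrib_mat_vec[OF Ac c0 d]
      by (rule eq_vecI) (use bz ba Ac Bc c0 d row in \<open>auto simp: ncon_block_def\<close>)
  qed
  finally show ?thesis unfolding rec_N_eq brec_eq_vconcat by simp
qed

end

section \<open>Output reachable sets\<close>

context dmodel_dims
begin

lemma GYN_carrier: "Gv \<in> carrier_mat nv gv \<Longrightarrow> GYN m N nu Gv \<in> carrier_mat ny (ngen N + gv)"
  unfolding GYN_def by (rule hcat_carrier[OF mult_carrier_mat[OF Fm GN_carrier] mult_carrier_mat[OF Dvm]])

lemma AYN_carrier: "Av \<in> carrier_mat qv gv \<Longrightarrow> AYN m N nu Av \<in> carrier_mat (ncon N + qv) (ngen N + gv)"
  unfolding AYN_def by (rule blkdiag_carrier[OF AN_carrier])

lemma cYN0_carrier: "cv \<in> carrier_vec nv \<Longrightarrow> cYN0 m N nu cv \<in> carrier_vec ny"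
  unfolding cYN0_def using Fm Dm Dvm cN_carrier by simp

lemma bYN0_carrier: "bv \<in> carrier_vec qv \<Longrightarrow> bYN0 m N nu bv \<in> carrier_vec (ncon N + qv)"
  unfolding bYN0_def using bN_carrier by simp

lemma YN_eq_czono:
  assumes Gv: "Gv \<in> carrier_mat nv gv" and cv: "cv \<in> carrier_vec nv"
    and Av: "Av \<in> carrier_mat qv gv" and bv: "bv \<in> carrier_vec qv"
    and ub: "ubar \<in> carrier_vec ((N + 1) * nu)"
  shows "YN m N nu Gv cv Av bv ubar =
    czono (GYN m N nu Gv) (cYN0 m N nu cv + (Fm m *\<^sub>v (Hmat m N nu N *\<^sub>v ubar) + Dm m *\<^sub>v useq nu ubar N))
      (AYN m N nu Av) (bYN0 m N nu bv + ((OmegaN m N nu *\<^sub>v ubar) @\<^sub>v 0\<^sub>v qv))"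
proof -
  let ?z = "zero_seq N nu" and ?uN = "useq nu ubar N"
  have "YN m N nu Gv cv Av bv ubar = czono (GYN m N nu Gv)
      (Fm m *\<^sub>v cN m N nu ubar + Dm m *\<^sub>v ?uN + Dvm m *\<^sub>v cv) (AYN m N nu Av) (bN m N nu ubar @\<^sub>v bv)"
    unfolding YN_def ZN_def GYN_def AYN_def GN_AN_input_indep[of N ubar ?z]
    by (rule czono_linear_image_sum[OF Fm GN_carrier cN_carrier AN_carrier bN_carrier
          mult_mat_vec_carrier[OF Dm useq_carrier] Dvm Gv cv Av])
  also have "Fm m *\<^sub>v cN m N nu ubar + Dm m *\<^sub>v ?uN + Dvm m *\<^sub>v cv =
      cYN0 m N nu cv + (Fm m *\<^sub>v (Hmat m N nu N *\<^sub>v ubar) + Dm m *\<^sub>v ?uN)"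
  proof -
    have c0: "cN m N nu ?z \<in> carrier_vec (n + nw)" by (rule cN_carrier)
    have Hu: "Hmat m N nu N *\<^sub>v ubar \<in> carrier_vec (n + nw)"
      using Hmat_carrier ub by (rule mult_mat_vec_carrier)
    have rearrange: "a + b + c + d = (a + 0\<^sub>v ny + d) + (b + c)"
      if "a \<in> carrier_vec ny" "b \<in> carrier_vec ny" "c \<in> carrier_vec ny" "d \<in> carrier_vec ny"
      for a b c d :: "real vec"
      using that by (intro eq_vecI) auto
    have "Dm m *\<^sub>v 0\<^sub>v nu = 0\<^sub>v ny" using carrier_matD[OF Dm] by simp
    then have "cYN0 m N nu cv = Fm m *\<^sub>v cN m N nu ?z + 0\<^sub>v ny + Dvm m *\<^sub>v cv"
      unfolding cYN0_def by simp
    moreover have "Fm m *\<^sub>v cN m N nu ubar = Fm m *\<^sub>v cN m N nu ?z + Fm m *\<^sub>v (Hmat m N nu N *\<^sub>v ubar)"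
      unfolding cN_affine[OF ub] by (rule mult_add_distrib_mat_vec[OF Fm c0 Hu])
    ultimately show ?thesis
      using rearrange[of "Fm m *\<^sub>v cN m N nu ?z" "Fm m *\<^sub>v (Hmat m N nu N *\<^sub>v ubar)"
          "Dm m *\<^sub>v ?uN" "Dvm m *\<^sub>v cv"] Fm Dm Dvm cv c0 Hu
      by simp
  qed
  also have "bN m N nu ubar @\<^sub>v bv = bYN0 m N nu bv + ((OmegaN m N nu *\<^sub>v ubar) @\<^sub>v 0\<^sub>v qv)"
  proof -
    have "bN m N nu ?z \<in> carrier_vec (ncon N)" by (rule bN_carrier)
    moreover have "OmegaN m N nu *\<^sub>v ubar \<in> carrier_vec (ncon N)"
      using OmegaN_carrier ub by (rule mult_mat_vec_carrier)
    ultimately show ?thesis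
      unfolding bN_affine[OF ub] bYN0_def
      using append_vec_add[of _ "ncon N" _ bv qv "0\<^sub>v qv"] bv by simp
  qed
  finally show ?thesis .
qed

end

locale dmodel_pair =
  I: dmodel_dims mi ny nu nv n1 nw1 r1 gz1 qz1 ga1 qa1 +
  J: dmodel_dims mj ny nu nv n2 nw2 r2 gz2 qz2 ga2 qa2
  for mi mj ny nu nv n1 nw1 r1 gz1 qz1 ga1 qa1 n2 nw2 r2 gz2 qz2 ga2 qa2
begin

lemma Nij_carrier: "Nij mi mj N nu \<in> carrier_mat ny ((N + 1) * nu)"
proof -
  have "hcat (0\<^sub>m ny (N * nu)) (Dm mj - Dm mi) \<in> carrier_mat ny ((N + 1) * nu)"
    using hcat_carrier[OF zero_carrier_mat[of ny "N * nu"] minus_carrier_mat[OF I.Dm, of "Dm mj"]]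
    by (simp add: algebra_simps)
  then show ?thesis
    unfolding Nij_def using I.Fm J.Fm I.Dm I.Hmat_carrier J.Hmat_carrier by simp
qed

lemma Nij_mult_vec:
  assumes ub: "ubar \<in> carrier_vec ((N + 1) * nu)"
  shows "Nij mi mj N nu *\<^sub>v ubar =
    (Fm mj *\<^sub>v (Hmat mj N nu N *\<^sub>v ubar) + Dm mj *\<^sub>v useq nu ubar N) -
    (Fm mi *\<^sub>v (Hmat mi N nu N *\<^sub>v ubar) + Dm mi *\<^sub>v useq nu ubar N)"
proof -
  let ?uN = "useq nu ubar N" and ?D = "hcat (0\<^sub>m ny (N * nu)) (Dm mj - Dm mi)"
  have FHi: "Fm mi * Hmat mi N nu N \<in> carrier_mat ny ((N + 1) * nu)"
    using I.Fm I.Hmat_carrier by (rule mult_carrier_mat)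
  have FHj: "Fm mj * Hmat mj N nu N \<in> carrier_mat ny ((N + 1) * nu)"
    using J.Fm J.Hmat_carrier by (rule mult_carrier_mat)
  have D: "Dm mj - Dm mi \<in> carrier_mat ny nu" using minus_carrier_mat[OF I.Dm] .
  have DC: "?D \<in> carrier_mat ny ((N + 1) * nu)"
    using hcat_carrier[OF zero_carrier_mat[of ny "N * nu"] D] by (simp add: algebra_simps)
  have "?D *\<^sub>v ubar = ?D *\<^sub>v (vec_first ubar (N * nu) @\<^sub>v ?uN)"
    unfolding append_useq_last[OF ub] ..
  also have "\<dots> = 0\<^sub>m ny (N * nu) *\<^sub>v vec_first ubar (N * nu) + (Dm mj - Dm mi) *\<^sub>v ?uN"
    by (rule hcat_mult_append_vec[OF zero_carrier_mat D]) simp_all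
  also have "\<dots> = Dm mj *\<^sub>v ?uN - Dm mi *\<^sub>v ?uN"
    using D mult_mat_vec_carrier[OF I.Dm useq_carrier] mult_mat_vec_carrier[OF J.Dm useq_carrier]
    by (simp add: minus_mult_distrib_mat_vec[OF J.Dm I.Dm])
  finally have Du: "?D *\<^sub>v ubar = Dm mj *\<^sub>v ?uN - Dm mi *\<^sub>v ?uN" .
  have Nij_eq: "Nij mi mj N nu = Fm mj * Hmat mj N nu N - Fm mi * Hmat mi N nu N + ?D"
    unfolding Nij_def carrier_matD(1)[OF I.Dm] ..
  have "Nij mi mj N nu *\<^sub>v ubar =
      Fm mj *\<^sub>v (Hmat mj N nu N *\<^sub>v ubar) - Fm mi *\<^sub>v (Hmat mi N nu N *\<^sub>v ubar) +
      (Dm mj *\<^sub>v ?uN - Dm mi *\<^sub>v ?uN)"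
    unfolding Nij_eq add_mult_distrib_mat_vec[OF minus_carrier_mat[OF FHi] DC ub]
      minus_mult_distrib_mat_vec[OF FHj FHi ub] Du
      assoc_mult_mat_vec[OF I.Fm I.Hmat_carrier ub] assoc_mult_mat_vec[OF J.Fm J.Hmat_carrier ub] ..
  moreover have "a - b + (c - d) = (a + c) - (b + d)"
    if "a \<in> carrier_vec ny" "b \<in> carrier_vec ny" "c \<in> carrier_vec ny" "d \<in> carrier_vec ny"
    for a b c d :: "real vec"
    using that by (intro eq_vecI) auto
  ultimately show ?thesis
    using I.Fm J.Fm I.Dm J.Dm mult_mat_vec_carrier[OF I.Hmat_carrier ub]
      mult_mat_vec_carrier[OF J.Hmat_carrier ub] by simp
qed

lemma Omegaij_carrier:
  "bv \<in> carrier_vec qv \<Longrightarrow>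
   Omegaij mi mj N nu bv \<in> carrier_mat (I.ncon N + (qv + (J.ncon N + qv))) ((N + 1) * nu)"
  unfolding Omegaij_def using I.OmegaN_carrier J.OmegaN_carrier by auto

lemma Omegaij_mult_vec:
  assumes bv: "bv \<in> carrier_vec qv" and ub: "ubar \<in> carrier_vec ((N + 1) * nu)"
  shows "Omegaij mi mj N nu bv *\<^sub>v ubar =
    ((OmegaN mi N nu *\<^sub>v ubar) @\<^sub>v 0\<^sub>v qv) @\<^sub>v ((OmegaN mj N nu *\<^sub>v ubar) @\<^sub>v 0\<^sub>v qv)"
proof -
  let ?Z = "0\<^sub>m qv ((N + 1) * nu)"
  have Z: "?Z \<in> carrier_mat qv ((N + 1) * nu)" by simp
  have J: "OmegaN mj N nu @\<^sub>r ?Z \<in> carrier_mat (J.ncon N + qv) ((N + 1) * nu)"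
    using J.OmegaN_carrier Z by (rule carrier_append_rows)
  have ZJ: "?Z @\<^sub>r OmegaN mj N nu @\<^sub>r ?Z \<in> carrier_mat (qv + (J.ncon N + qv)) ((N + 1) * nu)"
    using Z J by (rule carrier_append_rows)
  have "Omegaij mi mj N nu bv *\<^sub>v ubar =
      (OmegaN mi N nu *\<^sub>v ubar) @\<^sub>v (?Z *\<^sub>v ubar) @\<^sub>v (OmegaN mj N nu *\<^sub>v ubar) @\<^sub>v (?Z *\<^sub>v ubar)"
    unfolding Omegaij_def carrier_vecD[OF bv]
    by (simp only: mat_mult_append[OF I.OmegaN_carrier ZJ ub] mat_mult_append[OF Z J ub]
        mat_mult_append[OF J.OmegaN_carrier Z ub])
  then show ?thesis using ub by (simp add: append_vec_assoc)
qed

lemma YN_disjoint_iff: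
  assumes Gv: "Gv \<in> carrier_mat nv gv" and cv: "cv \<in> carrier_vec nv"
    and Av: "Av \<in> carrier_mat qv gv" and bv: "bv \<in> carrier_vec qv"
    and ub: "ubar \<in> carrier_vec ((N + 1) * nu)"
  shows "YN mi N nu Gv cv Av bv ubar \<inter> YN mj N nu Gv cv Av bv ubar = {} \<longleftrightarrow>
    (Nij mi mj N nu @\<^sub>r Omegaij mi mj N nu bv) *\<^sub>v ubar \<notin> Yij mi mj N nu Gv cv Av bv"
proof -
  let ?d1 = "Fm mi *\<^sub>v (Hmat mi N nu N *\<^sub>v ubar) + Dm mi *\<^sub>v useq nu ubar N"
  let ?d2 = "Fm mj *\<^sub>v (Hmat mj N nu N *\<^sub>v ubar) + Dm mj *\<^sub>v useq nu ubar N"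
  let ?e1 = "(OmegaN mi N nu *\<^sub>v ubar) @\<^sub>v 0\<^sub>v qv" and ?e2 = "(OmegaN mj N nu *\<^sub>v ubar) @\<^sub>v 0\<^sub>v qv"
  have "(Nij mi mj N nu @\<^sub>r Omegaij mi mj N nu bv) *\<^sub>v ubar = (?d2 - ?d1) @\<^sub>v ?e1 @\<^sub>v ?e2"
    by (simp add: mat_mult_append[OF Nij_carrier Omegaij_carrier[OF bv] ub]
        Nij_mult_vec[OF ub] Omegaij_mult_vec[OF bv ub])
  moreover have "Yij mi mj N nu Gv cv Av bv =
      zono (hcat (GYN mi N nu Gv) (- GYN mj N nu Gv) @\<^sub>r blkdiag (AYN mi N nu Av) (AYN mj N nu Av))
        ((cYN0 mi N nu cv - cYN0 mj N nu cv) @\<^sub>v - (bYN0 mi N nu bv @\<^sub>v bYN0 mj N nu bv))"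
    unfolding Yij_def GYij_def AYij_def cYij_def bYij_def ..
  moreover have "?d1 \<in> carrier_vec ny" "?d2 \<in> carrier_vec ny"
    using I.Fm J.Fm I.Dm J.Dm mult_mat_vec_carrier[OF I.Hmat_carrier ub]
      mult_mat_vec_carrier[OF J.Hmat_carrier ub] by auto
  moreover have "?e1 \<in> carrier_vec (I.ncon N + qv)" "?e2 \<in> carrier_vec (J.ncon N + qv)"
    using mult_mat_vec_carrier[OF I.OmegaN_carrier ub] mult_mat_vec_carrier[OF J.OmegaN_carrier ub]
    by auto
  ultimately show ?thesis
    unfolding I.YN_eq_czono[OF assms] J.YN_eq_czono[OF assms]
    by (simp only: czono_disjoint_iff_not_mem_zono[OF I.GYN_carrier[OF Gv] J.GYN_carrier[OF Gv]
        I.AYN_carrier[OF Av] J.AYN_carrier[OF Av] I.cYN0_carrier[OF cv] J.cYN0_carrier[OF cv] _ _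
        I.bYN0_carrier[OF bv] _ J.bYN0_carrier[OF bv]])
qed

end

theorem theorem1:
  fixes nm N nu ny nv gv qv :: nat
    and mdl :: "nat \<Rightarrow> dmodel"
    and U :: "real vec set"
    and Gv Av :: "real mat" and cv bv :: "real vec"
    and ubar :: "real vec"
  assumes models: "\<forall>i \<in> {1..nm}. wf_model ny nu nv (mdl i)"
    and V: "Gv \<in> carrier_mat nv gv" "cv \<in> carrier_vec nv"
           "Av \<in> carrier_mat qv gv" "bv \<in> carrier_vec qv"
    and u: "ubar \<in> Ubar N nu U"
  shows "(\<forall>i \<in> {1..nm}. \<forall>j \<in> {1..nm}. i \<noteq> j \<longrightarrow>
            YN (mdl i) N nu Gv cv Av bv ubar \<inter> YN (mdl j) N nu Gv cv Av bv ubar = {})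
     \<longleftrightarrow> (\<forall>i \<in> {1..nm}. \<forall>j \<in> {1..nm}. i \<noteq> j \<longrightarrow>
            (Nij (mdl i) (mdl j) N nu @\<^sub>r Omegaij (mdl i) (mdl j) N nu bv) *\<^sub>v ubar
              \<notin> Yij (mdl i) (mdl j) N nu Gv cv Av bv)"
proof -
  have ub: "ubar \<in> carrier_vec ((N + 1) * nu)" using u unfolding Ubar_def by blast
  have "YN (mdl i) N nu Gv cv Av bv ubar \<inter> YN (mdl j) N nu Gv cv Av bv ubar = {} \<longleftrightarrow>
      (Nij (mdl i) (mdl j) N nu @\<^sub>r Omegaij (mdl i) (mdl j) N nu bv) *\<^sub>v ubar
        \<notin> Yij (mdl i) (mdl j) N nu Gv cv Av bv"
    if "i \<in> {1..nm}" "j \<in> {1..nm}" for i j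
  proof -
    have "wf_model ny nu nv (mdl i)" "wf_model ny nu nv (mdl j)" using models that by blast+
    then obtain n1 nw1 r1 gz1 qz1 ga1 qa1 n2 nw2 r2 gz2 qz2 ga2 qa2
      where I: "dmodel_dims (mdl i) ny nu nv n1 nw1 r1 gz1 qz1 ga1 qa1"
        and J: "dmodel_dims (mdl j) ny nu nv n2 nw2 r2 gz2 qz2 ga2 qa2"
      by (meson wf_model_dmodel_dims)
    show ?thesis by (rule dmodel_pair.YN_disjoint_iff[OF dmodel_pair.intro[OF I J] V ub])
  qed
  then show ?thesis by blast
qed

end
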